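(* Let $X_1,X_2,X_3\subset\mathbb{R}^d$ be compact and let $\mu_i\in\mathcal{P}(X_i)$ satisfy $\mu_1\preceq_c\mu_2\preceq_c\mu_3$. Suppose that $\pi^{12}=\mu_1\otimes\kappa_1^2\in\Pi_M(\mu_1,\mu_2)$ and $\pi^{13}=\mu_1\otimes\kappa_1^3\in\Pi_M(\mu_1,\mu_3)$ are two martingale couplings such that for $\mu_1$-almost every $x_1$ we have $\kappa_1^2(x_1,dx_2)\preceq_c\kappa_1^3(x_1,dx_3)$. Then there exists a martingale coupling $\pi^{123}\in\Pi_M(\mu_1,\mu_2,\mu_3)$ such that $$\mathrm{Proj}_{12}(\pi^{123})=\pi^{12},\qquad \mathrm{Proj}_{13}(\pi^{123})=\pi^{13}.$$
   Context: $\mathcal{P}(X)$ is the set of Borel probability measures on $X$. Convex order: $\mu\preceq_c\nu$ means $\int\varphi\,d\mu\le\int\varphi\,d\nu$ for all convex $\varphi:\mathbb{R}^d\to\mathbb{R}$. $\Pi(\mu_1,\dots,\mu_n)$ is the set of probability measures on $X_1\times\dots\times X_n$ with $i$-th marginal $\mu_i$. $\mathrm{Proj}_I(\pi)$ is the marginal of $\pi$ on the coordinates indexed by $I$. $\mu\otimes\kappa$ denotes the joint measure with marginal $\mu$ and conditional probability kernel $\kappa$; $\kappa_1^i(x_1,dx_i)$ is the conditional probability of $x_i$ given $x_1$. Martingale couplings: $\Pi_M(\mu_1,\dots,\mu_n)$ is the set of $\pi\in\Pi(\mu_1,\dots,\mu_n)$ such that for each $i=1,\dots,n-1$, disintegrating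 $\pi=\mathrm{Proj}_{1\dots i}(\pi)\otimes\kappa_{1\dots i}^{i+1,\dots,n}$, one has $\int x_{i+1}\,\kappa_{1\dots i}^{i+1,\dots,n}(x_1,\dots,x_i,dx_{i+1},\dots,dx_n)=x_i$ for $\mathrm{Proj}_{1\dots i}(\pi)$-almost every $(x_1,\dots,x_i)$. (For $\Pi_M(\mu_1,\mu_3)$ the same definition is used with the two marginals $\mu_1,\mu_3$.) *)

theory Defs
  imports "HOL-Analysis.Analysis" "HOL-Probability.Probability"
begin

text \<open>
  Throughout, \<open>M\<^sub>i\<close> stands for the measurable space \<open>X\<^sub>i\<close>. A measure \<open>\<mu>\<^sub>i\<close> on \<open>X\<^sub>i\<close> is itself used in
  such an argument position, where only its underlying space and sigma-algebra matter. A point of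
  \<open>X\<^sub>1 \<times> X\<^sub>2 \<times> X\<^sub>3\<close> is a right-nested tuple.
\<close>

definition borel_probs :: "'a::topological_space set \<Rightarrow> 'a measure set" where
  "borel_probs X = space (prob_algebra (restrict_space borel X))"

text \<open>
  Finite convex functions are continuous, hence integrable against any probability measure
  on a compact set; the Lebesgue integrals below are used only for such measures.
\<close>

definition convex_order :: "'a::euclidean_space measure \<Rightarrow> 'a measure \<Rightarrow> bool"
    (infix "\<preceq>\<^sub>c" 50) where
  "\<mu> \<preceq>\<^sub>c \<nu> \<longleftrightarrow>
    (\<forall>\<phi>::'a \<Rightarrow> real. convex_on UNIV \<phi> \<longrightarrow> integral\<^sup>L \<mu> \<phi> \<le> integral\<^sup>L \<nu> \<phi>)"

text \<open>\<open>joint \<mu> N \<kappa>\<close> is \<open>\<mu> \<otimes> \<kappa>\<close> for a probability kernel \<open>\<kappa>\<close> from \<open>\<mu>\<close> to \<open>N\<close>.\<close>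

definition joint :: "'a measure \<Rightarrow> 'b measure \<Rightarrow> ('a \<Rightarrow> 'b measure) \<Rightarrow> ('a \<times> 'b) measure" where
  "joint \<mu> N \<kappa> = \<mu> \<bind> (\<lambda>x. distr (\<kappa> x) (\<mu> \<Otimes>\<^sub>M N) (Pair x))"

definition Proj12 ::
    "'a measure \<Rightarrow> 'b measure \<Rightarrow> ('a \<times> 'b \<times> 'c) measure \<Rightarrow> ('a \<times> 'b) measure" where
  "Proj12 M1 M2 \<pi> = distr \<pi> (M1 \<Otimes>\<^sub>M M2) (\<lambda>(x1, x2, x3). (x1, x2))"

definition Proj13 ::
    "'a measure \<Rightarrow> 'c measure \<Rightarrow> ('a \<times> 'b \<times> 'c) measure \<Rightarrow> ('a \<times> 'c) measure" where
  "Proj13 M1 M3 \<pi> = distr \<pi> (M1 \<Otimes>\<^sub>M M3) (\<lambda>(x1, x2, x3). (x1, x3))"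

definition couplings2 :: "'a measure \<Rightarrow> 'b measure \<Rightarrow> ('a \<times> 'b) measure set" where
  "couplings2 \<mu>1 \<mu>2 =
    {\<pi> \<in> space (prob_algebra (\<mu>1 \<Otimes>\<^sub>M \<mu>2)). distr \<pi> \<mu>1 fst = \<mu>1 \<and> distr \<pi> \<mu>2 snd = \<mu>2}"

definition couplings3 ::
    "'a measure \<Rightarrow> 'b measure \<Rightarrow> 'c measure \<Rightarrow> ('a \<times> 'b \<times> 'c) measure set" where
  "couplings3 \<mu>1 \<mu>2 \<mu>3 =
    {\<pi> \<in> space (prob_algebra (\<mu>1 \<Otimes>\<^sub>M (\<mu>2 \<Otimes>\<^sub>M \<mu>3))).
      distr \<pi> \<mu>1 (\<lambda>(x1, x2, x3). x1) = \<mu>1 \<and>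
      distr \<pi> \<mu>2 (\<lambda>(x1, x2, x3). x2) = \<mu>2 \<and>
      distr \<pi> \<mu>3 (\<lambda>(x1, x2, x3). x3) = \<mu>3}"

text \<open>
  Disintegrations are almost everywhere unique, so it is immaterial which one is used in the
  barycentre conditions. The existential form does not presuppose that one exists.
\<close>

definition martingale_couplings2 ::
    "'a::euclidean_space measure \<Rightarrow> 'a measure \<Rightarrow> ('a \<times> 'a) measure set" where
  "martingale_couplings2 \<mu>1 \<mu>2 =
    {\<pi> \<in> couplings2 \<mu>1 \<mu>2.
      \<exists>\<kappa> \<in> \<mu>1 \<rightarrow>\<^sub>M prob_algebra \<mu>2.
        \<pi> = joint (distr \<pi> \<mu>1 fst) \<mu>2 \<kappa> \<and>
        (AE x1 in distr \<pi> \<mu>1 fst. (\<integral>x2. x2 \<partial>\<kappa> x1) = x1)}"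

text \<open>
  In the triple case the two existential clauses are the conditions for \<open>i = 1\<close> and \<open>i = 2\<close>; for
  \<open>i = 2\<close> the measure is first reassociated to a measure on \<open>(X\<^sub>1 \<times> X\<^sub>2) \<times> X\<^sub>3\<close>.
\<close>

definition martingale_couplings3 ::
    "'a::euclidean_space measure \<Rightarrow> 'a measure \<Rightarrow> 'a measure \<Rightarrow> ('a \<times> 'a \<times> 'a) measure set" where
  "martingale_couplings3 \<mu>1 \<mu>2 \<mu>3 =
    {\<pi> \<in> couplings3 \<mu>1 \<mu>2 \<mu>3.
      (\<exists>\<kappa> \<in> \<mu>1 \<rightarrow>\<^sub>M prob_algebra (\<mu>2 \<Otimes>\<^sub>M \<mu>3).
        \<pi> = joint (distr \<pi> \<mu>1 fst) (\<mu>2 \<Otimes>\<^sub>M \<mu>3) \<kappa> \<and>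
        (AE x1 in distr \<pi> \<mu>1 fst. (\<integral>(x2, x3). x2 \<partial>\<kappa> x1) = x1)) \<and>
      (\<exists>\<kappa> \<in> \<mu>1 \<Otimes>\<^sub>M \<mu>2 \<rightarrow>\<^sub>M prob_algebra \<mu>3.
        distr \<pi> ((\<mu>1 \<Otimes>\<^sub>M \<mu>2) \<Otimes>\<^sub>M \<mu>3) (\<lambda>(x1, x2, x3). ((x1, x2), x3)) =
          joint (Proj12 \<mu>1 \<mu>2 \<pi>) \<mu>3 \<kappa> \<and>
        (AE (x1, x2) in Proj12 \<mu>1 \<mu>2 \<pi>. (\<integral>x3. x3 \<partial>\<kappa> (x1, x2)) = x2))}"

end

theory Submission
  imports Defs
begin

text \<open>
  For a linear combination of the constraints on the unknown coupling (prescribed \<open>(1,3)\<close>-marginal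
  and barycentre \<open>x\<^sub>2\<close> of \<open>x\<^sub>3\<close> given \<open>(x\<^sub>1, x\<^sub>2)\<close>), the convex order of \<open>\<kappa>\<^sub>1\<^sup>2(x\<^sub>1)\<close> and \<open>\<kappa>\<^sub>1\<^sup>3(x\<^sub>1)\<close>,
  applied for each \<open>x\<^sub>1\<close> to a convex envelope, says that no such combination is strictly negative.
  Hahn-Banach then gives a positive linear functional with first marginal \<open>\<pi>\<^sup>1\<^sup>2\<close> annihilating all
  constraints. No measurable selection is needed, because \<open>x\<^sub>1\<close> is part of the space on which the
  functional acts.

  To turn the functional into a kernel, \<open>X\<^sub>3\<close> is covered by a continuous image of the sequence space
  over a finite alphabet. There the functional is determined by its values on (measurable set)
  \<open>\<times>\<close> cylinder; their Radon-Nikodym densities form, almost everywhere, a consistent tree of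
  probabilities, which the Ionescu-Tulcea theorem extends to a measure depending measurably on
  \<open>(x\<^sub>1, x\<^sub>2)\<close>.
\<close>

section \<open>Positive functionals with a prescribed marginal\<close>

text \<open>The barycentre condition has to hold against every bounded measurable function of (x1,
  x2), and the convex envelopes vary with x1 without any control. Working with all functions that
  are bounded on the fibres asks for no regularity in either place; the price is a functional that
  is only finitely additive. Countable additivity is recovered in two different ways. In (x1, x2) it
  comes from domination: the mass of E times any set is at most the mass of E under
  \<open>\<pi>12\<close>. In x3 it comes from coding points by sequences: consistent nonnegative
  weights on the cylinders over a finite alphabet always extend to a measure. The coding by binary
  digits is not injective, and its range is a whole cube around X3. Neither matters: the constraints
  see a sequence only through the point it codes, and the prescribed (1,3)-marginal puts almost
  every such point into X3. Since finite additivity tolerates only uniform limits, a test function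
  of x3 must be determined by finitely many digits up to a uniform error. This is why the law of
  (x1, x3) is tested against Lipschitz functions and identified afterwards.\<close>

lemma hahn_banach_functions:
  fixes V :: "('x \<Rightarrow> real) set" and p :: "('x \<Rightarrow> real) \<Rightarrow> real"
  assumes V0: "(\<lambda>_. 0) \<in> V"
    and Vadd: "\<And>f g. f \<in> V \<Longrightarrow> g \<in> V \<Longrightarrow> (\<lambda>x. f x + g x) \<in> V"
    and Vscale: "\<And>c f. f \<in> V \<Longrightarrow> (\<lambda>x. c * f x) \<in> V"
    and p0: "p (\<lambda>_. 0) = 0"
    and padd: "\<And>f g. f \<in> V \<Longrightarrow> g \<in> V \<Longrightarrow> p (\<lambda>x. f x + g x) \<le> p f + p g"
    and pscale: "\<And>c f. f \<in> V \<Longrightarrow> 0 < c \<Longrightarrow> p (\<lambda>x. c * f x) \<le> c * p f"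
  obtains \<Lambda> where "\<And>f g. f \<in> V \<Longrightarrow> g \<in> V \<Longrightarrow> \<Lambda> (\<lambda>x. f x + g x) = \<Lambda> f + \<Lambda> g"
    and "\<And>c f. f \<in> V \<Longrightarrow> \<Lambda> (\<lambda>x. c * f x) = c * \<Lambda> f"
    and "\<And>f. f \<in> V \<Longrightarrow> \<Lambda> f \<le> (p f :: real)"
proof -
  \<comment> \<open>Zorn's lemma is applied to sublinear functionals below \<open>p\<close>, not to
    linear functionals on subspaces: a pointwise minimal one is automatically linear, so no domains
    have to be extended.\<close>
  define sub where "sub r \<longleftrightarrow> r (\<lambda>_. 0) = 0 \<and>
      (\<forall>f\<in>V. \<forall>g\<in>V. r (\<lambda>x. f x + g x) \<le> r f + r g) \<and>
      (\<forall>f\<in>V. \<forall>c>0. r (\<lambda>x. c * f x) \<le> c * r f)" for r :: "('x \<Rightarrow> real) \<Rightarrow> real"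
  have sub0: "r (\<lambda>_. 0) = 0" if "sub r" for r
    using that by (auto simp: sub_def)
  have subadd: "r (\<lambda>x. f x + g x) \<le> r f + r g" if "sub r" "f \<in> V" "g \<in> V" for r f g
    using that by (auto simp: sub_def)
  have subscale: "r (\<lambda>x. c * f x) = c * r f" if r: "sub r" "f \<in> V" and c: "0 \<le> c" for r f c
  proof (cases "c = 0")
    case False
    with c have c: "0 < c" by simp
    have "r (\<lambda>x. c * f x) \<le> c * r f"
      using r c by (auto simp: sub_def)
    moreover have "r (\<lambda>x. inverse c * (c * f x)) \<le> inverse c * r (\<lambda>x. c * f x)"
      using r c Vscale[of f c] by (auto simp: sub_def simp del: mult.assoc)
    ultimately show ?thesis
      using c by (simp add: field_simps)
  qed (use sub0 r in auto)
  have subneg: "- r (\<lambda>x. - f x) \<le> r f" if "sub r" "f \<in> V" for r f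
    using subadd[OF that(1,2) Vscale[OF that(2), of "-1"]] sub0[OF that(1)] by simp
  have Vneg: "(\<lambda>x. - f x) \<in> V" if "f \<in> V" for f
    using Vscale[OF that, of "-1"] by simp

  \<comment> \<open>The value 0 off \<open>V\<close> is a normalisation. With free values there,
    they could be lowered forever and no minimal element would exist.\<close>
  define S where "S = {r. sub r \<and> (\<forall>f\<in>V. r f \<le> p f) \<and> (\<forall>f. f \<notin> V \<longrightarrow> r f = 0)}"
  have "\<exists>m\<in>S. \<forall>a\<in>S. (\<forall>f. a f \<le> m f) \<longrightarrow> a = m"
  proof (rule predicate_Zorn[where P="\<lambda>a b. \<forall>f. b f \<le> (a f :: real)"])
    show "partial_order_on S (relation_of (\<lambda>a b. \<forall>f. b f \<le> a f) S)"
      by (rule partial_order_on_relation_ofI) (auto intro: order_trans intro!: ext antisym)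
  next
    fix C assume C: "C \<in> Chains (relation_of (\<lambda>a b. \<forall>f. b f \<le> (a f :: real)) S)"
    have CS: "C \<subseteq> S" and chain: "\<And>a b. a \<in> C \<Longrightarrow> b \<in> C \<Longrightarrow> (\<forall>f. b f \<le> a f) \<or> (\<forall>f. a f \<le> b f)"
      using C by (auto simp: Chains_def relation_of_def)
    show "\<exists>u\<in>S. \<forall>a\<in>C. \<forall>f. u f \<le> a f"
    proof (cases "C = {}")
      case True
      have "sub p" using p0 padd pscale by (auto simp: sub_def)
      then have "sub (\<lambda>f. if f \<in> V then p f else 0)"
        using V0 Vadd Vscale by (auto simp: sub_def)
      then have "(\<lambda>f. if f \<in> V then p f else 0) \<in> S"
        by (auto simp: S_def)
      then show ?thesis using True by auto
    next
      case False
      have lb: "- p (\<lambda>x. - f x) \<le> r f" if "r \<in> C" "f \<in> V" for r f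
      proof -
        have "sub r" "r (\<lambda>x. - f x) \<le> p (\<lambda>x. - f x)"
          using that CS Vneg by (auto simp: S_def)
        then show ?thesis using subneg[of r f] that by linarith
      qed
      \<comment> \<open>The lower bound \<open>- p (\<lambda>x. - f x)\<close> is common to the
        whole chain, so the infimum is finite.\<close>
      define u where "u f = (if f \<in> V then INF r\<in>C. r f else 0)" for f
      have bdd: "bdd_below ((\<lambda>r. r f) ` C)" if "f \<in> V" for f
        using lb[OF _ that] by (auto simp: bdd_below_def)
      have u_le: "u f \<le> r f" if "r \<in> C" for r f
      proof (cases "f \<in> V")
        case True
        then show ?thesis using that bdd by (auto simp: u_def intro!: cINF_lower)
      next
        case False
        then show ?thesis using that CS by (auto simp: u_def S_def)
      qed
      have u_ge: "b \<le> u f" if "f \<in> V" "\<And>r. r \<in> C \<Longrightarrow> b \<le> r f" for b f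
        using that \<open>C \<noteq> {}\<close> by (auto simp: u_def intro!: cINF_greatest)
      have "sub u"
        unfolding sub_def
      proof (intro conjI ballI allI impI)
        have "u (\<lambda>_. 0) = (INF r\<in>C. (0::real))"
          using V0 CS sub0 by (auto simp: u_def S_def intro!: INF_cong)
        then show "u (\<lambda>_. 0) = 0" using False by simp
      next
        fix f g assume f: "f \<in> V" and g: "g \<in> V"
        have *: "u (\<lambda>x. f x + g x) \<le> r f + s g" if rs: "r \<in> C" "s \<in> C" for r s
        proof -
          \<comment> \<open>Subadditivity of an infimum needs one functional below both
            \<open>r\<close> and \<open>s\<close>; in a chain the smaller of the two serves.\<close>
          obtain t where t: "t \<in> C" "t f \<le> r f" "t g \<le> s g"
            using chain[OF rs] rs by (metis order_refl)
          have "u (\<lambda>x. f x + g x) \<le> t (\<lambda>x. f x + g x)" by (rule u_le[OF t(1)])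
          also have "\<dots> \<le> t f + t g"
            using t CS subadd f g by (auto simp: S_def)
          finally show ?thesis using t by linarith
        qed
        have "u (\<lambda>x. f x + g x) - r f \<le> u g" if "r \<in> C" for r
          using *[OF that] by (intro u_ge[OF g]) (simp add: algebra_simps)
        then have "u (\<lambda>x. f x + g x) - u g \<le> u f"
          by (intro u_ge[OF f]) (simp add: algebra_simps)
        then show "u (\<lambda>x. f x + g x) \<le> u f + u g" by simp
      next
        fix f and c :: real assume f: "f \<in> V" and c: "0 < c"
        have "u (\<lambda>x. c * f x) / c \<le> u f"
        proof (rule u_ge[OF f])
          fix r assume r: "r \<in> C"
          have "u (\<lambda>x. c * f x) \<le> r (\<lambda>x. c * f x)" by (rule u_le[OF r])
          also have "\<dots> = c * r f" using r CS f c by (intro subscale) (auto simp: S_def)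
          finally show "u (\<lambda>x. c * f x) / c \<le> r f" using c by (simp add: field_simps)
        qed
        then show "u (\<lambda>x. c * f x) \<le> c * u f" using c by (simp add: field_simps)
      qed
      moreover have "u f \<le> p f" if "f \<in> V" for f
      proof -
        obtain r where "r \<in> C" using False by auto
        then have "u f \<le> r f" "r f \<le> p f" using u_le CS that by (auto simp: S_def)
        then show ?thesis by simp
      qed
      ultimately have "u \<in> S" by (auto simp: S_def u_def)
      then show ?thesis using u_le by auto
    qed
  qed
  then obtain m where mS: "m \<in> S" and min: "\<And>a. a \<in> S \<Longrightarrow> (\<And>f. a f \<le> m f) \<Longrightarrow> a = m"
    by blast
  have m: "sub m" and m_le: "\<And>f. f \<in> V \<Longrightarrow> m f \<le> p f" and m_out: "\<And>f. f \<notin> V \<Longrightarrow> m f = 0"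
    using mS by (auto simp: S_def)
  have Vt: "(\<lambda>x. f x + t * g x) \<in> V" if "f \<in> V" "g \<in> V" for f g t
    by (rule Vadd[OF that(1) Vscale[OF that(2)]])
  have super: "m f + m g \<le> m (\<lambda>x. f x + g x)" if g: "g \<in> V" and "f \<in> V" for f g
  proof -
    \<comment> \<open>\<open>r\<close> is sublinear and \<open>r \<le> m\<close>, so minimality forces \<open>r = m\<close>, and \<open>t = 1\<close> gives superadditivity.\<close>
    define r where "r f = (if f \<in> V then INF t\<in>{0..}. m (\<lambda>x. f x + t * g x) - t * m g else 0)" for f
    have lb: "- m (\<lambda>x. - f x) \<le> m (\<lambda>x. f x + t * g x) - t * m g" if "f \<in> V" "0 \<le> t" for f t
      using subadd[OF m Vt[OF that(1) g, of t] Vneg[OF that(1)]] subscale[OF m g that(2)] by simp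
    have bdd: "bdd_below ((\<lambda>t. m (\<lambda>x. f x + t * g x) - t * m g) ` {0..})" if "f \<in> V" for f
      using lb[OF that] by (auto simp: bdd_below_def)
    have r_le: "r f \<le> m (\<lambda>x. f x + t * g x) - t * m g" if "f \<in> V" "0 \<le> t" for f t
      using that bdd by (auto simp: r_def intro!: cINF_lower)
    have r_ge: "b \<le> r f" if "f \<in> V" "\<And>t. 0 \<le> t \<Longrightarrow> b \<le> m (\<lambda>x. f x + t * g x) - t * m g" for b f
      using that by (auto simp: r_def intro!: cINF_greatest)
    have r_m: "r f \<le> m f" for f
      using r_le[of f 0] m_out by (cases "f \<in> V") (auto simp: r_def)
    have "sub r"
      unfolding sub_def
    proof (intro conjI ballI allI impI)
      show "r (\<lambda>_. 0) = 0"
      proof (rule antisym)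
        show "r (\<lambda>_. 0) \<le> 0" using r_m[of "\<lambda>_. 0"] sub0[OF m] by simp
        show "0 \<le> r (\<lambda>_. 0)" using subscale[OF m g] by (intro r_ge[OF V0]) simp
      qed
    next
      fix f1 f2 assume f1: "f1 \<in> V" and f2: "f2 \<in> V"
      have *: "r (\<lambda>x. f1 x + f2 x) \<le> (m (\<lambda>x. f1 x + t * g x) - t * m g) + (m (\<lambda>x. f2 x + s * g x) - s * m g)"
        if "0 \<le> t" "0 \<le> s" for t s
      proof -
        have "r (\<lambda>x. f1 x + f2 x) \<le> m (\<lambda>x. (f1 x + f2 x) + (t + s) * g x) - (t + s) * m g"
          using that by (intro r_le Vadd f1 f2) simp
        also have "(\<lambda>x. (f1 x + f2 x) + (t + s) * g x) = (\<lambda>x. (f1 x + t * g x) + (f2 x + s * g x))"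
          by (auto simp: algebra_simps)
        also have "m \<dots> \<le> m (\<lambda>x. f1 x + t * g x) + m (\<lambda>x. f2 x + s * g x)"
          by (intro subadd m Vt f1 f2 g)
        finally show ?thesis by (simp add: algebra_simps)
      qed
      have "r (\<lambda>x. f1 x + f2 x) - (m (\<lambda>x. f1 x + t * g x) - t * m g) \<le> r f2" if "0 \<le> t" for t
        using *[OF that] by (intro r_ge[OF f2]) (simp add: algebra_simps)
      then have "r (\<lambda>x. f1 x + f2 x) - r f2 \<le> r f1"
        by (intro r_ge[OF f1]) (simp add: algebra_simps)
      then show "r (\<lambda>x. f1 x + f2 x) \<le> r f1 + r f2" by simp
    next
      fix f and c :: real assume f: "f \<in> V" and c: "0 < c"
      have "r (\<lambda>x. c * f x) / c \<le> r f"
      proof (rule r_ge[OF f])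
        fix t :: real assume t: "0 \<le> t"
        have "r (\<lambda>x. c * f x) \<le> m (\<lambda>x. c * f x + (c * t) * g x) - (c * t) * m g"
          using t c f by (intro r_le Vscale) auto
        also have "(\<lambda>x. c * f x + (c * t) * g x) = (\<lambda>x. c * (f x + t * g x))"
          by (auto simp: algebra_simps)
        also have "m \<dots> = c * m (\<lambda>x. f x + t * g x)"
          using c by (intro subscale m Vt f g) simp
        finally show "r (\<lambda>x. c * f x) / c \<le> m (\<lambda>x. f x + t * g x) - t * m g"
          using c by (simp add: field_simps)
      qed
      then show "r (\<lambda>x. c * f x) \<le> c * r f" using c by (simp add: field_simps)
    qed
    moreover have "r f \<le> p f" if "f \<in> V" for f
      using r_m[of f] m_le[OF that] by linarith
    ultimately have "r \<in> S" by (auto simp: S_def r_def)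
    then have "r = m" using r_m by (rule min)
    then show ?thesis using r_le[OF \<open>f \<in> V\<close>, of 1] by simp
  qed
  have add: "m (\<lambda>x. f x + g x) = m f + m g" if "f \<in> V" "g \<in> V" for f g
    using super[OF that(2,1)] subadd[OF m that] by simp
  have neg: "m (\<lambda>x. - f x) = - m f" if "f \<in> V" for f
    using add[OF that Vneg[OF that]] sub0[OF m] by simp
  have scale: "m (\<lambda>x. c * f x) = c * m f" if "f \<in> V" for c f
  proof (cases "0 \<le> c")
    case False
    have "m (\<lambda>x. - ((-c) * f x)) = - ((-c) * m f)"
      using False that Vscale[OF that, of "-c"] subscale[OF m that, of "-c"] by (subst neg) auto
    then show ?thesis by simp
  qed (use subscale[OF m that] in auto)
  show ?thesis by (rule that[OF add scale m_le])
qed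

text \<open>
  The bound is required only over \<open>space M\<close>: off that set the functions below take arbitrary values.
\<close>

definition fiber_bounded :: "'a measure \<Rightarrow> ('a \<times> 'b \<Rightarrow> real) \<Rightarrow> bool" where
  "fiber_bounded M F \<longleftrightarrow> (\<exists>b. \<forall>x\<in>space M. \<forall>w. \<bar>F (x, w)\<bar> \<le> b)"

lemma fiber_boundedI: "(\<And>x w. x \<in> space M \<Longrightarrow> \<bar>F (x, w)\<bar> \<le> b) \<Longrightarrow> fiber_bounded M F"
  by (auto simp: fiber_bounded_def)

lemma fiber_bounded_const: "fiber_bounded M (\<lambda>_. c)"
  by (rule fiber_boundedI[of _ _ "\<bar>c\<bar>"]) simp

lemma fiber_bounded_add:
  assumes "fiber_bounded M F" "fiber_bounded M G"
  shows "fiber_bounded M (\<lambda>z. F z + G z)"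
proof -
  obtain b c where "\<And>x w. x \<in> space M \<Longrightarrow> \<bar>F (x, w)\<bar> \<le> b" "\<And>x w. x \<in> space M \<Longrightarrow> \<bar>G (x, w)\<bar> \<le> c"
    using assms unfolding fiber_bounded_def by blast
  then show ?thesis
    by (intro fiber_boundedI[of _ _ "b + c"]) (rule order_trans[OF abs_triangle_ineq add_mono])
qed

lemma fiber_bounded_mult:
  assumes "fiber_bounded M F" "fiber_bounded M G"
  shows "fiber_bounded M (\<lambda>z. F z * G z)"
proof -
  obtain b c where b: "\<And>x w. x \<in> space M \<Longrightarrow> \<bar>F (x, w)\<bar> \<le> b"
    and c: "\<And>x w. x \<in> space M \<Longrightarrow> \<bar>G (x, w)\<bar> \<le> c"
    using assms unfolding fiber_bounded_def by blast
  show ?thesis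
  proof (rule fiber_boundedI[of _ _ "b * c"])
    fix x w assume "x \<in> space M"
    then show "\<bar>F (x, w) * G (x, w)\<bar> \<le> b * c"
      using b[of x w] c[of x w] by (auto simp: abs_mult intro!: mult_mono)
  qed
qed

lemma fiber_bounded_cmult: "fiber_bounded M F \<Longrightarrow> fiber_bounded M (\<lambda>z. c * F z)"
  by (rule fiber_bounded_mult[OF fiber_bounded_const])

lemma fiber_bounded_diff:
  "fiber_bounded M F \<Longrightarrow> fiber_bounded M G \<Longrightarrow> fiber_bounded M (\<lambda>z. F z - G z)"
  using fiber_bounded_add[of M F "\<lambda>z. -1 * G z"] fiber_bounded_cmult[of M G "-1"] by simp

lemma fiber_bounded_sum:
  "(\<And>i. i \<in> I \<Longrightarrow> fiber_bounded M (F i)) \<Longrightarrow> fiber_bounded M (\<lambda>z. \<Sum>i\<in>I. F i z)"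
  by (induction I rule: infinite_finite_induct) (auto intro: fiber_bounded_add fiber_bounded_const)

lemma fiber_bounded_fst: "(\<And>x. x \<in> space M \<Longrightarrow> \<bar>f x\<bar> \<le> b) \<Longrightarrow> fiber_bounded M (\<lambda>z. f (fst z))"
  by (rule fiber_boundedI[of _ _ b]) simp

lemma fiber_bounded_snd: "(\<And>w. \<bar>g w\<bar> \<le> b) \<Longrightarrow> fiber_bounded M (\<lambda>z. g (snd z))"
  by (rule fiber_boundedI[of _ _ b]) simp

lemma fiber_bounded_indicators: "fiber_bounded M (\<lambda>z. indicator E (fst z) * indicator C (snd z))"
  by (rule fiber_boundedI[of _ _ 1]) (auto simp: indicator_def)

text \<open>A finitely additive stand-in for a probability measure on a product whose first marginal
  is \<open>M\<close>. Nothing is required to be measurable in the second variable; only functions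
  of the first variable are tied to honest integrals.\<close>

locale fiber_functional = prob_space M for M :: "'a measure" +
  fixes \<Lambda> :: "('a \<times> 'b \<Rightarrow> real) \<Rightarrow> real"
  assumes add: "\<And>F G. fiber_bounded M F \<Longrightarrow> fiber_bounded M G \<Longrightarrow> \<Lambda> (\<lambda>z. F z + G z) = \<Lambda> F + \<Lambda> G"
    and cmult: "\<And>c F. fiber_bounded M F \<Longrightarrow> \<Lambda> (\<lambda>z. c * F z) = c * \<Lambda> F"
    and mono: "\<And>F G. fiber_bounded M F \<Longrightarrow> fiber_bounded M G \<Longrightarrow>
      (\<And>x w. x \<in> space M \<Longrightarrow> F (x, w) \<le> G (x, w)) \<Longrightarrow> \<Lambda> F \<le> \<Lambda> G"
    and marginal: "\<And>f b. f \<in> borel_measurable M \<Longrightarrow> (\<And>x. x \<in> space M \<Longrightarrow> \<bar>f x\<bar> \<le> b) \<Longrightarrow>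
      \<Lambda> (\<lambda>z. f (fst z)) = integral\<^sup>L M f"
begin

lemma diff: "fiber_bounded M F \<Longrightarrow> fiber_bounded M G \<Longrightarrow> \<Lambda> (\<lambda>z. F z - G z) = \<Lambda> F - \<Lambda> G"
  using add[of F "\<lambda>z. -1 * G z"] cmult[of G "-1"] fiber_bounded_cmult[of M G "-1"] by simp

lemma const: "\<Lambda> (\<lambda>_. c) = c"
  using marginal[of "\<lambda>_. c" "\<bar>c\<bar>"] by (simp add: prob_space)

lemma sum:
  assumes "finite I" "\<And>i. i \<in> I \<Longrightarrow> fiber_bounded M (F i)"
  shows "\<Lambda> (\<lambda>z. \<Sum>i\<in>I. F i z) = (\<Sum>i\<in>I. \<Lambda> (F i))"
  using assms by (induction I rule: finite_induct) (auto simp: const add fiber_bounded_sum)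

text \<open>A positive functional of total mass 1 is a contraction for the uniform distance. Uniform
  approximation is the only limit argument available for \<Lambda>.\<close>

lemma dist_le:
  assumes F: "fiber_bounded M F" and G: "fiber_bounded M G"
    and le: "\<And>x w. x \<in> space M \<Longrightarrow> \<bar>F (x, w) - G (x, w)\<bar> \<le> c"
  shows "\<bar>\<Lambda> F - \<Lambda> G\<bar> \<le> c"
proof -
  have D: "fiber_bounded M (\<lambda>z. F z - G z)" by (rule fiber_bounded_diff[OF F G])
  have "\<Lambda> (\<lambda>z. F z - G z) \<le> \<Lambda> (\<lambda>_. c)"
    by (rule mono[OF D fiber_bounded_const]) (use le abs_le_D1 in blast)
  moreover have "\<Lambda> (\<lambda>_. - c) \<le> \<Lambda> (\<lambda>z. F z - G z)"
    by (rule mono[OF fiber_bounded_const D]) (use le abs_le_D2 minus_le_iff in blast)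
  ultimately show ?thesis by (simp add: diff[OF F G] const)
qed

lemma cong:
  assumes "fiber_bounded M F" "\<And>x w. x \<in> space M \<Longrightarrow> F (x, w) = G (x, w)"
  shows "\<Lambda> F = \<Lambda> G"
proof -
  have "fiber_bounded M G" using assms by (auto simp: fiber_bounded_def)
  from dist_le[OF assms(1) this, of 0] assms(2) show ?thesis by simp
qed

end

text \<open>Hypothesis \<open>nonneg\<close> is the feasibility condition of the dual problem. It
  keeps the sublinear bound finite and makes it vanish at 0, which is all that Hahn-Banach asks for
  besides sublinearity.\<close>

lemma fiber_functional_extension:
  fixes M :: "'a measure" and L :: "('a \<times> 'b \<Rightarrow> real) set"
  assumes M: "prob_space M"
    and LB: "\<And>F. F \<in> L \<Longrightarrow> fiber_bounded M F" and L0: "(\<lambda>_. 0) \<in> L"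
    and Ladd: "\<And>F G. F \<in> L \<Longrightarrow> G \<in> L \<Longrightarrow> (\<lambda>z. F z + G z) \<in> L"
    and Lscale: "\<And>c F. F \<in> L \<Longrightarrow> (\<lambda>z. c * F z) \<in> L"
    and nonneg: "\<And>F f b. F \<in> L \<Longrightarrow> f \<in> borel_measurable M \<Longrightarrow> (\<And>x. x \<in> space M \<Longrightarrow> \<bar>f x\<bar> \<le> b) \<Longrightarrow>
       (\<And>x w. x \<in> space M \<Longrightarrow> F (x, w) \<le> f x) \<Longrightarrow> 0 \<le> integral\<^sup>L M f"
  shows "\<exists>\<Lambda>. fiber_functional M \<Lambda> \<and> (\<forall>F\<in>L. \<Lambda> F = 0)"
proof -
  interpret prob_space M by fact
  define B where "B = {F :: 'a \<times> 'b \<Rightarrow> real. fiber_bounded M F}"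
  define bm where "bm = {f \<in> borel_measurable M. \<exists>b. \<forall>x\<in>space M. \<bar>f x :: real\<bar> \<le> b}"
  have bmI: "f \<in> bm" if "f \<in> borel_measurable M" "\<And>x. x \<in> space M \<Longrightarrow> \<bar>f x\<bar> \<le> b" for f b
    using that by (auto simp: bm_def)
  have bmc: "(\<lambda>_. c) \<in> bm" for c
    by (auto simp: bm_def)
  have bm_int: "integrable M f" if "f \<in> bm" for f
    using that by (auto simp: bm_def intro!: integrable_const_bound AE_I2)
  have bm_add: "(\<lambda>x. f x + g x) \<in> bm" if *: "f \<in> bm" "g \<in> bm" for f g
  proof -
    obtain b c where "\<And>x. x \<in> space M \<Longrightarrow> \<bar>f x\<bar> \<le> b" "\<And>x. x \<in> space M \<Longrightarrow> \<bar>g x\<bar> \<le> c"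
      using * unfolding bm_def by blast
    then have "\<bar>f x + g x\<bar> \<le> b + c" if "x \<in> space M" for x
      using that by (smt (verit))
    then show ?thesis using * by (auto simp: bm_def)
  qed
  have bm_scale: "(\<lambda>x. c * f x) \<in> bm" if *: "f \<in> bm" for f c
  proof -
    obtain b where "\<And>x. x \<in> space M \<Longrightarrow> \<bar>f x\<bar> \<le> b"
      using * by (auto simp: bm_def)
    then have "\<bar>c * f x\<bar> \<le> \<bar>c\<bar> * b" if "x \<in> space M" for x
      using that by (auto simp: abs_mult intro!: mult_left_mono)
    then show ?thesis using * by (auto simp: bm_def)
  qed
  have Badd: "(\<lambda>z. F z + G z) \<in> B" if "F \<in> B" "G \<in> B" for F G
    using that by (simp add: B_def fiber_bounded_add)
  have Bscale: "(\<lambda>z. c * F z) \<in> B" if "F \<in> B" for F c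
    using that by (simp add: B_def fiber_bounded_cmult)
  \<comment> \<open>The upper integral of the fibrewise supremum, minimised over translates by \<open>L\<close>: a linear functional
    below it has the right marginal and vanishes on \<open>L\<close>.\<close>
  define A where "A F = {f \<in> bm. \<exists>G\<in>L. \<forall>x\<in>space M. \<forall>w. F (x, w) + G (x, w) \<le> f x}" for F
  have AI: "f \<in> A F" if "f \<in> bm" "G \<in> L" "\<And>x w. x \<in> space M \<Longrightarrow> F (x, w) + G (x, w) \<le> f x" for f F G
    using that unfolding A_def by blast
  define p where "p F = (INF f\<in>A F. integral\<^sup>L M f)" for F
  have A_ne: "A F \<noteq> {}" if F: "F \<in> B" for F
  proof -
    obtain b where b: "\<And>x w. x \<in> space M \<Longrightarrow> \<bar>F (x, w)\<bar> \<le> b"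
      using F by (auto simp: B_def fiber_bounded_def)
    have "(\<lambda>_. b) \<in> bm" by (auto simp: bm_def)
    moreover have "F (x, w) + 0 \<le> b" if "x \<in> space M" for x w
      using b[OF that, of w] by linarith
    ultimately have "(\<lambda>_. b) \<in> A F"
      by (intro AI[OF _ L0]) auto
    then show ?thesis by auto
  qed
  \<comment> \<open>If F + G lies below f and |F| is at most b, then G lies below f + b, and
    \<open>nonneg\<close> applied to G gives that the integral of f is at least -b.\<close>
  have lb: "\<exists>b. \<forall>f\<in>A F. b \<le> integral\<^sup>L M f" if F: "F \<in> B" for F
  proof -
    obtain b where b: "\<And>x w. x \<in> space M \<Longrightarrow> \<bar>F (x, w)\<bar> \<le> b"
      using F by (auto simp: B_def fiber_bounded_def)
    have "- b \<le> integral\<^sup>L M f" if fA: "f \<in> A F" for f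
    proof -
      obtain G where f: "f \<in> bm" and G: "G \<in> L" "\<And>x w. x \<in> space M \<Longrightarrow> F (x, w) + G (x, w) \<le> f x"
        using fA by (auto simp: A_def)
      have "(\<lambda>x. f x + b) \<in> bm" by (intro bm_add f bmc)
      then obtain c where c: "\<And>x. x \<in> space M \<Longrightarrow> \<bar>f x + b\<bar> \<le> c" "(\<lambda>x. f x + b) \<in> borel_measurable M"
        by (auto simp: bm_def)
      have "G (x, w) \<le> f x + b" if "x \<in> space M" for x w
        using G(2)[OF that, of w] b[OF that, of w] by linarith
      then have "0 \<le> (\<integral>x. f x + b \<partial>M)"
        using nonneg[OF G(1) c(2), of c] c(1) by blast
      then show ?thesis using bm_int[OF f] by (simp add: prob_space)
    qed
    then show ?thesis by auto
  qed
  have p_le: "p F \<le> integral\<^sup>L M f" if "F \<in> B" "f \<in> A F" for F f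
    unfolding p_def using lb[OF that(1)] that(2) by (intro cINF_lower) (auto simp: bdd_below_def)
  have p_ge: "b \<le> p F" if "F \<in> B" "\<And>f. f \<in> A F \<Longrightarrow> b \<le> integral\<^sup>L M f" for F b
    unfolding p_def using A_ne[OF that(1)] that(2) by (intro cINF_greatest)
  have B0: "(\<lambda>_. 0) \<in> B" by (auto simp: B_def fiber_bounded_def)
  have bm0: "(\<lambda>_. 0) \<in> bm" by (auto simp: bm_def)
  \<comment> \<open>This is the source of positivity: a linear functional below \<open>p\<close> is
    nonpositive on nonpositive functions.\<close>
  have p_nonpos: "p F \<le> 0" if F: "F \<in> B" "\<And>x w. x \<in> space M \<Longrightarrow> F (x, w) \<le> 0" for F
  proof -
    have "(\<lambda>_. 0) \<in> A F"
      using F by (intro AI[OF bm0 L0]) auto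
    from p_le[OF F(1) this] show ?thesis by simp
  qed
  have p_zero: "p (\<lambda>_. 0) = 0"
  proof (rule antisym)
    show "0 \<le> p (\<lambda>_. 0)"
    proof (rule p_ge[OF B0])
      fix f assume "f \<in> A (\<lambda>_. 0)"
      then obtain G b where "G \<in> L" "f \<in> borel_measurable M"
        "\<And>x. x \<in> space M \<Longrightarrow> \<bar>f x\<bar> \<le> b" "\<And>x w. x \<in> space M \<Longrightarrow> G (x, w) \<le> f x"
        unfolding A_def bm_def mem_Collect_eq add_0 by blast
      then show "0 \<le> integral\<^sup>L M f" by (rule nonneg)
    qed
  qed (rule p_nonpos[OF B0], simp)
  have p_add: "p (\<lambda>z. F z + G z) \<le> p F + p G" if F: "F \<in> B" and G: "G \<in> B" for F G
  proof -
    have *: "p (\<lambda>z. F z + G z) \<le> integral\<^sup>L M f + integral\<^sup>L M g" if f: "f \<in> A F" and g: "g \<in> A G" for f g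
    proof -
      obtain F' where f: "f \<in> bm" and F': "F' \<in> L" "\<And>x w. x \<in> space M \<Longrightarrow> F (x, w) + F' (x, w) \<le> f x"
        using f by (auto simp: A_def)
      obtain G' where g: "g \<in> bm" and G': "G' \<in> L" "\<And>x w. x \<in> space M \<Longrightarrow> G (x, w) + G' (x, w) \<le> g x"
        using g by (auto simp: A_def)
      have "(F (x, w) + G (x, w)) + (F' (x, w) + G' (x, w)) \<le> f x + g x" if "x \<in> space M" for x w
        using F'(2)[OF that, of w] G'(2)[OF that, of w] by linarith
      then have "(\<lambda>x. f x + g x) \<in> A (\<lambda>z. F z + G z)"
        by (intro AI[OF bm_add[OF f g] Ladd[OF F'(1) G'(1)]])
      from p_le[OF Badd[OF F G] this] show ?thesis
        using bm_int[OF f] bm_int[OF g] by simp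
    qed
    have "p (\<lambda>z. F z + G z) - integral\<^sup>L M f \<le> p G" if "f \<in> A F" for f
      using *[OF that] by (intro p_ge[OF G]) (simp add: algebra_simps)
    then have "p (\<lambda>z. F z + G z) - p G \<le> p F"
      by (intro p_ge[OF F]) (simp add: algebra_simps)
    then show ?thesis by simp
  qed
  have p_scale: "p (\<lambda>z. c * F z) \<le> c * p F" if F: "F \<in> B" and c: "0 < c" for F c
  proof -
    have "p (\<lambda>z. c * F z) / c \<le> p F"
    proof (rule p_ge[OF F])
      fix f assume "f \<in> A F"
      then obtain G where f: "f \<in> bm" and G: "G \<in> L" "\<And>x w. x \<in> space M \<Longrightarrow> F (x, w) + G (x, w) \<le> f x"
        by (auto simp: A_def)
      have "c * F (x, w) + c * G (x, w) \<le> c * f x" if "x \<in> space M" for x w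
        using mult_left_mono[OF G(2)[OF that], of c w] c by (simp add: distrib_left)
      then have "(\<lambda>x. c * f x) \<in> A (\<lambda>z. c * F z)"
        by (intro AI[OF bm_scale[OF f] Lscale[OF G(1)]])
      from p_le[OF Bscale[OF F] this] show "p (\<lambda>z. c * F z) / c \<le> integral\<^sup>L M f"
        using c by (simp add: field_simps)
    qed
    then show ?thesis using c by (simp add: field_simps)
  qed
  obtain \<Lambda> where add: "\<And>F G. F \<in> B \<Longrightarrow> G \<in> B \<Longrightarrow> \<Lambda> (\<lambda>z. F z + G z) = \<Lambda> F + \<Lambda> G"
    and scale: "\<And>c F. F \<in> B \<Longrightarrow> \<Lambda> (\<lambda>z. c * F z) = c * \<Lambda> F"
    and le: "\<And>F. F \<in> B \<Longrightarrow> \<Lambda> F \<le> p F"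
    by (rule hahn_banach_functions[of B p, OF B0 Badd Bscale p_zero p_add p_scale]) blast+
  have neg: "\<Lambda> (\<lambda>z. - F z) = - \<Lambda> F" if "F \<in> B" for F
    using scale[OF that, of "-1"] by simp
  have mono: "\<Lambda> F \<le> \<Lambda> G" if F: "F \<in> B" and G: "G \<in> B"
    and FG: "\<And>x w. x \<in> space M \<Longrightarrow> F (x, w) \<le> G (x, w)" for F G
  proof -
    have F': "(\<lambda>z. - G z) \<in> B" using Bscale[OF G, of "-1"] by simp
    have "\<Lambda> (\<lambda>z. F z + - G z) \<le> 0"
      by (rule order_trans[OF le[OF Badd[OF F F']] p_nonpos[OF Badd[OF F F']]]) (simp add: FG)
    then show ?thesis using add[OF F F'] neg[OF G] by simp
  qed
  have fstB: "(\<lambda>z. f (fst z)) \<in> B" if "f \<in> bm" for f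
    using that by (auto simp: bm_def B_def fiber_bounded_def)
  have fst_le: "\<Lambda> (\<lambda>z. f (fst z)) \<le> integral\<^sup>L M f" if f: "f \<in> bm" for f
  proof -
    have "f \<in> A (\<lambda>z. f (fst z))"
      by (intro AI[OF f L0]) auto
    then show ?thesis
      by (rule order_trans[OF le[OF fstB[OF f]] p_le[OF fstB[OF f]]])
  qed
  have int: "\<Lambda> (\<lambda>z. f (fst z)) = integral\<^sup>L M f" if f: "f \<in> bm" for f
  proof -
    have "(\<lambda>x. - f x) \<in> bm" using bm_scale[OF f, of "-1"] by simp
    from fst_le[OF this] fst_le[OF f] show ?thesis
      using neg[OF fstB[OF f]] by simp
  qed
  \<comment> \<open>Translating F by its own negative, again an element of \<open>L\<close>, shows
    that the constant 0 is admissible for F. Applied to F and to -F this gives the value 0 on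
    \<open>L\<close>.\<close>
  have L_le: "\<Lambda> F \<le> 0" if F: "F \<in> L" for F
  proof -
    have "(\<lambda>z. - F z) \<in> L" using Lscale[OF F, of "-1"] by simp
    then have "(\<lambda>_. 0) \<in> A F"
      by (intro AI[OF bm0]) auto
    moreover have "F \<in> B" using F LB by (auto simp: B_def)
    ultimately show ?thesis using le[of F] p_le[of F "\<lambda>_. 0"] by simp
  qed
  have L_zero: "\<Lambda> F = 0" if F: "F \<in> L" for F
  proof -
    have "(\<lambda>z. - F z) \<in> L" using Lscale[OF F, of "-1"] by simp
    from L_le[OF this] L_le[OF F] neg[of F] show ?thesis using F LB by (auto simp: B_def)
  qed
  have "fiber_functional M \<Lambda>"
  proof (rule fiber_functional.intro[OF M], rule fiber_functional_axioms.intro)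
    show "\<Lambda> (\<lambda>z. f (fst z)) = integral\<^sup>L M f"
      if "f \<in> borel_measurable M" "\<And>x. x \<in> space M \<Longrightarrow> \<bar>f x\<bar> \<le> b" for f b
      using that by (intro int bmI)
  qed (use add scale mono in \<open>auto simp: B_def\<close>)
  with L_zero show ?thesis by blast
qed

section \<open>Kernels into a sequence space\<close>

text \<open>Domination upgrades finite to countable additivity: along a sequence decreasing to the
  empty set the measures under \<open>M\<close> tend to 0 and drag \<nu> along. Radon-Nikodym then
  applies.\<close>

lemma additive_dominated_density:
  fixes \<nu> :: "'a set \<Rightarrow> real"
  assumes M: "finite_measure M"
    and add: "\<And>A B. A \<in> sets M \<Longrightarrow> B \<in> sets M \<Longrightarrow> A \<inter> B = {} \<Longrightarrow> \<nu> (A \<union> B) = \<nu> A + \<nu> B"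
    and nonneg: "\<And>A. A \<in> sets M \<Longrightarrow> 0 \<le> \<nu> A"
    and dom: "\<And>A. A \<in> sets M \<Longrightarrow> \<nu> A \<le> measure M A"
  obtains k where "k \<in> borel_measurable M" "\<And>x. 0 \<le> k x" "integrable M k"
    "\<And>A. A \<in> sets M \<Longrightarrow> (\<integral>x. indicator A x * k x \<partial>M) = \<nu> A"
proof -
  interpret finite_measure M by fact
  have nu0: "\<nu> {} = 0" using dom[of "{}"] nonneg[of "{}"] by simp
  define N where "N = measure_of (space M) (sets M) (\<lambda>A. ennreal (\<nu> A))"
  have pos: "positive (sets M) (\<lambda>A. ennreal (\<nu> A))"
    using nu0 by (auto simp: positive_def)
  have "countably_additive (sets M) (\<lambda>A. ennreal (\<nu> A))"
  proof (rule sets.empty_continuous_imp_countably_additive[OF pos])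
    show "additive (sets M) (\<lambda>A. ennreal (\<nu> A))"
      using add nonneg by (auto simp: additive_def ennreal_plus[symmetric] simp del: ennreal_plus)
    fix A :: "nat \<Rightarrow> 'a set"
    assume A: "range A \<subseteq> sets M" "decseq A" "(\<Inter>i. A i) = {}"
    have "(\<lambda>i. measure M (A i)) \<longlonglongrightarrow> 0"
      using finite_Lim_measure_decseq[OF A(1,2)] A(3) by simp
    then have "(\<lambda>i. \<nu> (A i)) \<longlonglongrightarrow> 0"
      using A by (intro tendsto_sandwich[OF _ _ tendsto_const[of 0] \<open>(\<lambda>i. measure M (A i)) \<longlonglongrightarrow> 0\<close>])
        (auto intro!: always_eventually nonneg dom)
    then show "(\<lambda>i. ennreal (\<nu> (A i))) \<longlonglongrightarrow> 0"
      by (metis ennreal_0 tendsto_ennrealI)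
  qed auto
  then have N: "emeasure N A = ennreal (\<nu> A)" if "A \<in> sets M" for A
    unfolding N_def using that pos sets.space_closed by (intro emeasure_measure_of_sigma sets.sigma_algebra_axioms)
  have sN: "sets N = sets M" by (simp add: N_def)
  have "absolutely_continuous M N"
    unfolding absolutely_continuous_def null_sets_def
    using N dom nonneg by (auto simp: sN measure_def) (metis enn2real_0 order_antisym ennreal_0)
  from Radon_Nikodym[OF this sN] obtain f where f: "f \<in> borel_measurable M" "density M f = N"
    by auto
  have int: "(\<integral>\<^sup>+x. f x * indicator A x \<partial>M) = ennreal (\<nu> A)" if "A \<in> sets M" for A
    using N[OF that] emeasure_density[OF f(1) that] f(2) by simp
  have "(\<integral>\<^sup>+x. f x \<partial>M) = ennreal (\<nu> (space M))"
    using int[OF sets.top] by (subst nn_integral_cong[where v="\<lambda>x. f x * indicator (space M) x"]) auto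
  then have fin: "AE x in M. f x \<noteq> \<infinity>"
    using f(1) by (intro nn_integral_PInf_AE) auto
  \<comment> \<open>The density is infinite only on a null set, so making it real changes no
    integral.\<close>
  define k where "k x = enn2real (f x)" for x
  have k[measurable]: "k \<in> borel_measurable M" using f unfolding k_def by measurable
  have k_nonneg: "0 \<le> k x" for x by (simp add: k_def)
  have nn: "(\<integral>\<^sup>+x. ennreal (indicator A x * k x) \<partial>M) = ennreal (\<nu> A)" if "A \<in> sets M" for A
  proof -
    have "(\<integral>\<^sup>+x. ennreal (indicator A x * k x) \<partial>M) = (\<integral>\<^sup>+x. f x * indicator A x \<partial>M)"
      using fin by (intro nn_integral_cong_AE, eventually_elim)
        (auto simp: k_def indicator_def less_top)
    then show ?thesis using int[OF that] by simp
  qed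
  show ?thesis
  proof (rule that[of k])
    show "integrable M k"
      by (intro integrableI_nonneg) (use nn[OF sets.top] in \<open>auto simp: k_def cong: nn_integral_cong\<close>)
    show "(\<integral>x. indicator A x * k x \<partial>M) = \<nu> A" if A[measurable]: "A \<in> sets M" for A
      using nn[OF A] nonneg[OF A] by (subst integral_eq_nn_integral) (auto simp: k_nonneg)
  qed (auto simp: k_def)
qed

text \<open>With the second factor frozen, \<Lambda> is additive in \<open>E\<close> and bounded by
  the measure of \<open>E\<close>. The set \<open>C\<close> may be arbitrary, since \<Lambda> makes
  no measurability demand there.\<close>

lemma (in fiber_functional) rect_density:
  "\<exists>k. k \<in> borel_measurable M \<and> (\<forall>x. 0 \<le> k x) \<and> integrable M k \<and>
    (\<forall>E\<in>sets M. (\<integral>x. indicator E x * k x \<partial>M) = \<Lambda> (\<lambda>z. indicator E (fst z) * indicator C (snd z)))"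
proof (rule additive_dominated_density[of M "\<lambda>E. \<Lambda> (\<lambda>z. indicator E (fst z) * indicator C (snd z))"])
  show "finite_measure M" by unfold_locales
next
  fix E E' assume "E \<in> sets M" "E' \<in> sets M" "E \<inter> E' = {}"
  then have "(\<lambda>z. indicator (E \<union> E') (fst z) * indicator C (snd z) :: real) =
      (\<lambda>z. indicator E (fst z) * indicator C (snd z) + indicator E' (fst z) * indicator C (snd z))"
    by (auto simp: indicator_def fun_eq_iff)
  then show "\<Lambda> (\<lambda>z. indicator (E \<union> E') (fst z) * indicator C (snd z)) =
      \<Lambda> (\<lambda>z. indicator E (fst z) * indicator C (snd z)) + \<Lambda> (\<lambda>z. indicator E' (fst z) * indicator C (snd z))"
    by (simp add: add fiber_bounded_indicators)
next
  fix E assume E: "E \<in> sets M"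
  have "\<Lambda> (\<lambda>_. 0) \<le> \<Lambda> (\<lambda>z. indicator E (fst z) * indicator C (snd z))"
    by (rule mono[OF fiber_bounded_const fiber_bounded_indicators]) simp
  then show "0 \<le> \<Lambda> (\<lambda>z. indicator E (fst z) * indicator C (snd z))" by (simp add: const)
  have "\<Lambda> (\<lambda>z. indicator E (fst z) * indicator C (snd z)) \<le> \<Lambda> (\<lambda>z. indicator E (fst z))"
    by (rule mono[OF fiber_bounded_indicators fiber_bounded_fst[of _ _ 1]]) (auto simp: indicator_def)
  also have "\<dots> = measure M E"
    using E by (subst marginal[of _ 1]) (auto simp: indicator_def)
  finally show "\<Lambda> (\<lambda>z. indicator E (fst z) * indicator C (snd z)) \<le> measure M E" .
next
  fix k :: "'a \<Rightarrow> real"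
  assume "k \<in> borel_measurable M" "\<And>x. 0 \<le> k x" "integrable M k"
    "\<And>E. E \<in> sets M \<Longrightarrow> (\<integral>x. indicator E x * k x \<partial>M) = \<Lambda> (\<lambda>z. indicator E (fst z) * indicator C (snd z))"
  then show ?thesis by (intro exI[of _ k]) simp
qed

section \<open>Cylinder sets and measures on a sequence space\<close>

definition cylinder :: "'a list \<Rightarrow> (nat \<Rightarrow> 'a) set" where
  "cylinder ws = {\<omega>. map \<omega> [0..<length ws] = ws}"

abbreviation seq_space :: "(nat \<Rightarrow> 'a) measure" where
  "seq_space \<equiv> Pi\<^sub>M UNIV (\<lambda>_. count_space UNIV)"

lemma cylinder_iff: "\<omega> \<in> cylinder ws \<longleftrightarrow> (\<forall>i<length ws. \<omega> i = ws ! i)"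
  unfolding cylinder_def mem_Collect_eq by (subst list_eq_iff_nth_eq) simp

lemma cylinder_Nil [simp]: "cylinder [] = UNIV"
  by (simp add: cylinder_def)

lemma cylinder_snoc: "cylinder (ws @ [a]) = cylinder ws \<inter> {\<omega>. \<omega> (length ws) = a}"
  by (auto simp: cylinder_def)

lemma sets_cylinder [measurable]: "cylinder ws \<in> sets (seq_space :: (nat \<Rightarrow> 'a) measure)"
proof (induction ws rule: rev_induct)
  case Nil
  show ?case
    using sets.top[of "seq_space :: (nat \<Rightarrow> 'a) measure"] by (simp add: space_PiM)
next
  case (snoc a ws)
  have "(\<lambda>\<omega>. \<omega> (length ws)) -` {a} \<inter> space seq_space \<in> sets (seq_space :: (nat \<Rightarrow> 'a) measure)"
    by (rule measurable_sets[OF measurable_component_singleton]) auto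
  then show ?case
    using sets.Int[OF snoc, of "{\<omega>. \<omega> (length ws) = a}"] by (simp add: cylinder_snoc vimage_def space_PiM)
qed

lemma cylinder_Int:
  assumes "length u \<le> length v"
  shows "cylinder u \<inter> cylinder v = (if take (length u) v = u then cylinder v else {})"
proof -
  have "map \<omega> [0..<length u] = take (length u) v" if "map \<omega> [0..<length v] = v" for \<omega> :: "nat \<Rightarrow> 'a"
    using arg_cong[OF that, of "take (length u)"] assms by (simp add: take_map)
  then show ?thesis by (auto simp: cylinder_def)
qed

text \<open>Two cylinders are nested or disjoint, according to whether one word is a prefix of the
  other; the empty set is adjoined for the disjoint case.\<close>

lemma Int_stable_cylinders: "Int_stable (insert {} (range cylinder))"
proof (rule Int_stableI)
  fix A B :: "(nat \<Rightarrow> 'a) set"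
  assume "A \<in> insert {} (range cylinder)" "B \<in> insert {} (range cylinder)"
  then consider "A = {} \<or> B = {}" | u v where "A = cylinder u" "B = cylinder v" by auto
  then show "A \<inter> B \<in> insert {} (range cylinder)"
  proof cases
    case 2
    then show ?thesis
      using cylinder_Int[of u v] cylinder_Int[of v u] by (cases "length u \<le> length v") (auto simp: Int_commute)
  qed auto
qed

text \<open>Over a finite alphabet a condition on coordinate i is a finite union of cylinders of
  words of length i + 1.\<close>

lemma sets_seq_space_eq_cylinders:
  "sets (seq_space :: (nat \<Rightarrow> 'a::finite) measure) = sigma_sets UNIV (insert {} (range cylinder))"
proof (rule antisym)
  show "sigma_sets UNIV (insert {} (range cylinder)) \<subseteq> sets (seq_space :: (nat \<Rightarrow> 'a) measure)"
    using sets.sigma_sets_subset[of "insert {} (range cylinder)" "seq_space :: (nat \<Rightarrow> 'a) measure"] sets_cylinder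
    by (simp add: space_PiM image_subset_iff)
  have "{\<omega>. \<omega> i \<in> A} \<in> sigma_sets UNIV (insert {} (range cylinder))" for i and A :: "'a set"
  proof -
    have "{\<omega>. \<omega> i \<in> A} = (\<Union>ws\<in>{ws. length ws = Suc i \<and> ws ! i \<in> A}. cylinder ws)" (is "?L = ?R")
    proof (intro set_eqI iffI)
      fix \<omega> assume "\<omega> \<in> ?L"
      then have "\<omega> \<in> cylinder (map \<omega> [0..<Suc i])" "map \<omega> [0..<Suc i] ! i \<in> A"
        by (auto simp: cylinder_def nth_append)
      then show "\<omega> \<in> ?R" by (intro UN_I[of "map \<omega> [0..<Suc i]"]) auto
    qed (auto simp: cylinder_iff)
    moreover have "finite {ws. length ws = Suc i \<and> ws ! i \<in> A}"
      by (rule finite_subset[OF _ finite_lists_length_eq[of "UNIV :: 'a set" "Suc i"]]) auto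
    moreover have "ring_of_sets UNIV (sigma_sets UNIV (insert {} (range (cylinder :: 'a list \<Rightarrow> _))))"
      by (intro algebra.axioms sigma_algebra.axioms(1) sigma_algebra_sigma_sets) auto
    ultimately show ?thesis
      by (auto intro!: ring_of_sets.finite_UN)
  qed
  then show "sets (seq_space :: (nat \<Rightarrow> 'a) measure) \<subseteq> sigma_sets UNIV (insert {} (range cylinder))"
    unfolding sets_PiM_single by (simp, intro sigma_sets_mono) auto
qed

text \<open>The weights are read as a process that appends letters: after the word ws, the letter a
  has conditional probability \<open>k (ws @ [a]) / k ws\<close>. Ionescu-Tulcea supplies the law of
  the infinite sequence, and multiplying the conditional probabilities along a word returns its
  weight.\<close>

lemma tree_measure:
  fixes k :: "'a::finite list \<Rightarrow> real"
  assumes nonneg: "\<And>ws. 0 \<le> k ws" and Nil: "k [] = 1"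
    and snoc: "\<And>ws. k ws = (\<Sum>a\<in>UNIV. k (ws @ [a]))"
  shows "\<exists>L. sets L = sets (seq_space :: (nat \<Rightarrow> 'a) measure) \<and> prob_space L \<and>
    (\<forall>ws. measure L (cylinder ws) = k ws)"
proof -
  \<comment> \<open>At a word of weight 0 any probability vector would do, because all its
    successors have weight 0 too; the uniform one is taken.\<close>
  define c where "c ws a = (if k ws = 0 then 1 / real CARD('a) else k (ws @ [a]) / k ws)" for ws a
  have c_nonneg: "0 \<le> c ws a" for ws a using nonneg by (simp add: c_def)
  have c_sum: "(\<Sum>a\<in>UNIV. c ws a) = 1" for ws
  proof (cases "k ws = 0")
    case False
    then have "(\<Sum>a\<in>UNIV. c ws a) = (\<Sum>a\<in>UNIV. k (ws @ [a])) / k ws"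
      by (simp add: c_def sum_divide_distrib)
    then show ?thesis using False by (simp flip: snoc)
  qed (simp add: c_def)
  have c_mult: "k ws * c ws a = k (ws @ [a])" for ws a
  proof (cases "k ws = 0")
    case True
    then have "(\<Sum>a\<in>UNIV. k (ws @ [a])) = 0" by (simp flip: snoc)
    then have "k (ws @ [a]) = 0" using nonneg by (subst (asm) sum_nonneg_eq_0_iff) auto
    then show ?thesis using True by simp
  qed (simp add: c_def)
  define P where "P n \<omega> = density (count_space (UNIV :: 'a set)) (\<lambda>a. ennreal (c (map \<omega> [0..<n]) a))" for n :: nat and \<omega> :: "nat \<Rightarrow> 'a"
  have P_prob: "prob_space (P n \<omega>)" for n \<omega>
    by (rule prob_spaceI)
      (simp add: P_def emeasure_density nn_integral_count_space_finite c_nonneg c_sum sum_ennreal)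
  have PiM_fin: "Pi\<^sub>M {0..<n} (\<lambda>_. count_space (UNIV :: 'a set)) = count_space (PiE {0..<n} (\<lambda>_. UNIV))" for n :: nat
    by (rule count_space_PiM_finite) auto
  interpret IT: Ionescu_Tulcea P "\<lambda>_. count_space (UNIV :: 'a set)"
  proof (unfold Ionescu_Tulcea_def, intro conjI allI impI)
    show "P i \<in> Pi\<^sub>M {0..<i} (\<lambda>_. count_space UNIV) \<rightarrow>\<^sub>M subprob_algebra (count_space UNIV)" for i
      unfolding PiM_fin using P_prob
      by (auto simp: space_subprob_algebra P_def prob_space_imp_subprob_space)
  qed (rule P_prob)
  \<comment> \<open>The trace of \<open>cylinder ws\<close> on the finite product of the first
    coordinates, which is where the finite stages of the process live.\<close>
  define D where "D ws = {\<omega> \<in> PiE {0..<length ws} (\<lambda>_. UNIV). map \<omega> [0..<length ws] = ws}" for ws :: "'a list"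
  have D_sets: "D ws \<in> sets (Pi\<^sub>M {0..<length ws} (\<lambda>_. count_space UNIV))" for ws
    unfolding PiM_fin by (auto simp: D_def)
  \<comment> \<open>The only point of the empty product, hence the only possible starting
    history.\<close>
  let ?u = "\<lambda>_::nat. undefined :: 'a"
  have CD: "emeasure (IT.C 0 (length ws) ?u) (D ws) = ennreal (k ws)" for ws
  proof (induction ws rule: rev_induct)
    case Nil
    then show ?case by (simp add: D_def PiM_empty assms(2))
  next
    case (snoc a ws)
    let ?n = "length ws"
    have "emeasure (IT.C 0 (length (ws @ [a])) ?u) (D (ws @ [a])) =
        (\<integral>\<^sup>+x. emeasure (IT.eP ?n x) (D (ws @ [a])) \<partial>IT.C 0 ?n ?u)"
      using D_sets[of "ws @ [a]"] IT.measurable_eP[of ?n]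
      by (simp, subst emeasure_bind[where N="Pi\<^sub>M {0..<Suc ?n} (\<lambda>_. count_space UNIV)"])
         (auto simp: IT.space_C cong: measurable_cong_sets[OF IT.sets_C])
    also have "\<dots> = (\<integral>\<^sup>+x. ennreal (c ws a) * indicator (D ws) x \<partial>IT.C 0 ?n ?u)"
    proof (rule nn_integral_cong)
      fix x assume "x \<in> space (IT.C 0 ?n ?u)"
      then have x: "x \<in> space (Pi\<^sub>M {0..<?n} (\<lambda>_. count_space UNIV))" by (simp add: IT.space_C)
      \<comment> \<open>From a history x the next step reaches the longer word only if x already
        spells \<open>ws\<close> and the new letter is \<open>a\<close>.\<close>
      have *: "(\<lambda>y. x(?n := y)) -` D (ws @ [a]) \<inter> UNIV = (if x \<in> D ws then {a} else {})"
      proof -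
        have "map (x(?n := y)) [0..<?n] = map x [0..<?n]" for y
          by (rule map_cong) auto
        then show ?thesis
          using x by (auto simp: D_def PiM_fin PiE_iff extensional_def simp del: fun_upd_apply)
            (auto simp: fun_upd_same)
      qed
      have "emeasure (IT.eP ?n x) (D (ws @ [a])) = emeasure (P ?n x) (if x \<in> D ws then {a} else {})"
        using IT.emeasure_eP[OF x, of "D (ws @ [a])"] D_sets[of "ws @ [a]"] * by simp
      also have "\<dots> = ennreal (c ws a) * indicator (D ws) x"
        by (auto simp: P_def emeasure_density nn_integral_count_space_finite D_def indicator_def)
      finally show "emeasure (IT.eP ?n x) (D (ws @ [a])) = ennreal (c ws a) * indicator (D ws) x" .
    qed
    also have "\<dots> = ennreal (c ws a) * ennreal (k ws)"
      using D_sets[of ws] by (subst nn_integral_cmult_indicator) (simp_all add: snoc IT.sets_C)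
    also have "\<dots> = ennreal (k (ws @ [a]))"
      by (subst mult.commute, subst c_mult[symmetric], rule ennreal_mult[OF nonneg c_nonneg, symmetric])
    finally show ?case .
  qed
  have emb: "IT.PF.emb UNIV {0..<length ws} (D ws) = cylinder ws" for ws
  proof -
    have r: "map (restrict x {0..<length ws}) [0..<length ws] = map x [0..<length ws]" for x :: "nat \<Rightarrow> 'a"
      by (rule map_cong) auto
    show ?thesis
      by (auto simp: r prod_emb_def D_def cylinder_def space_PiM PiE_iff simp del: restrict_apply)
  qed
  have emb': "IT.PF.emb {0..<length ws} {0..<length ws} (D ws) = D ws" for ws
    by (rule prod_emb_id) (auto simp: D_def)
  have L: "emeasure IT.PF.lim (cylinder ws) = ennreal (k ws)" for ws
    using IT.lim[of "{0..<length ws}" "D ws"] IT.emeasure_CI[of "{0..<length ws}" "length ws" "D ws"]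
      D_sets[of ws] CD[of ws] by (simp add: emb emb')
  have "prob_space IT.PF.lim"
    using L[of "[]"] by (intro prob_spaceI) (simp add: IT.PF.space_lim space_PiM assms(2))
  moreover have "measure IT.PF.lim (cylinder ws) = k ws" for ws
    using L nonneg by (simp add: measure_def)
  ultimately show ?thesis
    using IT.PF.sets_lim by blast
qed

lemma cylinder_split:
  "indicator (cylinder ws) \<omega> = (\<Sum>a\<in>UNIV. indicator (cylinder (ws @ [a])) (\<omega> :: nat \<Rightarrow> 'b::finite) :: real)"
proof -
  have "(\<Sum>a\<in>UNIV. indicator (cylinder (ws @ [a])) \<omega> :: real) =
      (\<Sum>a\<in>UNIV. if a = \<omega> (length ws) then indicator (cylinder ws) \<omega> else 0)"
    by (intro sum.cong) (auto simp: cylinder_snoc indicator_def)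
  then show ?thesis by simp
qed

text \<open>The tree identities hold after integration over every \<open>E\<close>, because
  \<Lambda> satisfies them; hence they hold almost everywhere for the densities. At each such point
  the densities of all cylinders form a tree of probabilities.\<close>

lemma fiber_functional_kernel:
  fixes \<Lambda> :: "('a \<times> (nat \<Rightarrow> 'b::finite) \<Rightarrow> real) \<Rightarrow> real"
  assumes "fiber_functional M \<Lambda>"
  obtains L where "L \<in> M \<rightarrow>\<^sub>M prob_algebra seq_space"
    "\<And>E ws. E \<in> sets M \<Longrightarrow> (\<integral>x. indicator E x * measure (L x) (cylinder ws) \<partial>M) =
        \<Lambda> (\<lambda>z. indicator E (fst z) * indicator (cylinder ws) (snd z))"
proof -
  interpret fiber_functional M \<Lambda> by fact
  define P where "P ws f \<longleftrightarrow> f \<in> borel_measurable M \<and> (\<forall>x. 0 \<le> f x) \<and> integrable M f \<and>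
    (\<forall>E\<in>sets M. (\<integral>x. indicator E x * f x \<partial>M) = \<Lambda> (\<lambda>z. indicator E (fst z) * indicator (cylinder ws) (snd z)))" for ws f
  have "\<forall>ws. \<exists>f. P ws f"
    unfolding P_def by (intro allI rect_density)
  then obtain k where "\<And>ws. P ws (k ws)" by metis
  then have k[measurable]: "\<And>ws. k ws \<in> borel_measurable M" and k_nonneg: "\<And>ws x. 0 \<le> k ws x"
    and k_int: "\<And>ws. integrable M (k ws)"
    and k: "\<And>ws E. E \<in> sets M \<Longrightarrow>
      (\<integral>x. indicator E x * k ws x \<partial>M) = \<Lambda> (\<lambda>z. indicator E (fst z) * indicator (cylinder ws) (snd z))"
    unfolding P_def by simp_all
  have "AE x in M. k [] x = 1"
  proof (rule density_unique_real)
    fix E assume E: "E \<in> sets M"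
    have "\<Lambda> (\<lambda>z. indicator E (fst z)) = measure M E"
      using E by (subst marginal[of _ 1]) (auto simp: indicator_def)
    then show "(\<integral>x\<in>E. k [] x \<partial>M) = (\<integral>x\<in>E. 1 \<partial>M)"
      using k[OF E, of "[]"] E by (simp add: set_lebesgue_integral_def)
  qed (use k_int in auto)
  moreover have "AE x in M. \<forall>ws. k ws x = (\<Sum>a\<in>UNIV. k (ws @ [a]) x)"
    \<comment> \<open>There are countably many words over a finite alphabet, so one null set serves
      for all of them.\<close>
    unfolding AE_all_countable
  proof (intro allI density_unique_real)
    fix ws E assume E: "E \<in> sets M"
    have "(\<integral>x\<in>E. (\<Sum>a\<in>UNIV. k (ws @ [a]) x) \<partial>M) = (\<Sum>a\<in>UNIV. (\<integral>x. indicator E x * k (ws @ [a]) x \<partial>M))"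
      unfolding set_lebesgue_integral_def real_scaleR_def sum_distrib_left
      using integrable_mult_indicator[OF E k_int] by (intro Bochner_Integration.integral_sum) simp
    also have "\<dots> = \<Lambda> (\<lambda>z. \<Sum>a\<in>UNIV. indicator E (fst z) * indicator (cylinder (ws @ [a])) (snd z))"
      by (subst sum) (simp_all add: fiber_bounded_indicators k[OF E])
    also have "\<dots> = (\<integral>x\<in>E. k ws x \<partial>M)"
      unfolding sum_distrib_left[symmetric] cylinder_split[symmetric]
      using k[OF E, of ws] by (simp add: set_lebesgue_integral_def)
    finally show "(\<integral>x\<in>E. k ws x \<partial>M) = (\<integral>x\<in>E. (\<Sum>a\<in>UNIV. k (ws @ [a]) x) \<partial>M)" ..
  qed (use k_int in auto)
  ultimately have good: "AE x in M. k [] x = 1 \<and> (\<forall>ws. k ws x = (\<Sum>a\<in>UNIV. k (ws @ [a]) x))"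
    by eventually_elim (intro conjI)
  define good where "good x \<longleftrightarrow> k [] x = 1 \<and> (\<forall>ws. k ws x = (\<Sum>a\<in>UNIV. k (ws @ [a]) x))" for x
  have [measurable]: "Measurable.pred M good"
    unfolding good_def by measurable
  \<comment> \<open>Uniform weights on the null set where the densities fail to be consistent.\<close>
  define k' where "k' x ws = (if good x then k ws x
      else (1 / real CARD('b)) ^ length ws)" for x ws
  have "\<exists>L. sets L = sets (seq_space :: (nat \<Rightarrow> 'b) measure) \<and> prob_space L \<and>
      (\<forall>ws. measure L (cylinder ws) = k' x ws)" for x
  proof (rule tree_measure)
    show "k' x ws = (\<Sum>a\<in>UNIV. k' x (ws @ [a]))" for ws
    proof (cases "good x")
      case True
      then have "k ws x = (\<Sum>a\<in>UNIV. k (ws @ [a]) x)" unfolding good_def by blast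
      with True show ?thesis by (simp add: k'_def)
    qed (simp add: k'_def)
    have "k [] x = 1" if "good x" using that unfolding good_def by blast
    then show "k' x [] = 1" by (simp add: k'_def)
  qed (simp add: k'_def k_nonneg)
  then obtain L where L_sets: "\<And>x. sets (L x) = sets (seq_space :: (nat \<Rightarrow> 'b) measure)"
    and L_prob: "\<And>x. prob_space (L x)" and L: "\<And>x ws. measure (L x) (cylinder ws) = k' x ws"
    by metis
  have k'_meas: "(\<lambda>x. k' x ws) \<in> borel_measurable M" for ws
    unfolding k'_def by measurable
  show ?thesis
  proof (rule that[of L])
    show "L \<in> M \<rightarrow>\<^sub>M prob_algebra seq_space"
    \<comment> \<open>The measures L x were chosen pointwise with no regard to measurability; it
      follows because they are determined by the cylinders, whose masses are measurable in
      x.\<close>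
    proof (rule measurable_prob_algebra_generated[OF sets_seq_space_eq_cylinders Int_stable_cylinders _ L_prob L_sets])
      fix A :: "(nat \<Rightarrow> 'b) set" assume "A \<in> insert {} (range cylinder)"
      then consider "A = {}" | ws where "A = cylinder ws" by auto
      then show "(\<lambda>x. emeasure (L x) A) \<in> borel_measurable M"
      proof cases
        case 2
        have "emeasure (L x) A = ennreal (k' x ws)" for x
          using L[of x ws] 2 finite_measure.emeasure_eq_measure[OF prob_space.finite_measure[OF L_prob]] by simp
        then show ?thesis using k'_meas by simp
      qed simp
    qed simp
    fix E ws assume E[measurable]: "E \<in> sets M"
    have "(\<integral>x. indicator E x * measure (L x) (cylinder ws) \<partial>M) = (\<integral>x. indicator E x * k ws x \<partial>M)"
      unfolding L using k'_meas good[folded good_def] by (intro integral_cong_AE) (auto simp: k'_def)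
    then show "(\<integral>x. indicator E x * measure (L x) (cylinder ws) \<partial>M) =
        \<Lambda> (\<lambda>z. indicator E (fst z) * indicator (cylinder ws) (snd z))"
      using k[OF E] by simp
  qed
qed

section \<open>Approximation by functions of finitely many letters\<close>

definition pad :: "'a list \<Rightarrow> nat \<Rightarrow> 'a" where
  "pad ws = (\<lambda>i. if i < length ws then ws ! i else undefined)"

text \<open>The value of \<open>G\<close> at a fixed representative of each cylinder of length
  \<open>n\<close>. The form as a combination of cylinder indicators allows comparison term by term,
  while \<open>trunc_eq\<close> gives the pointwise form.\<close>

definition trunc :: "nat \<Rightarrow> ((nat \<Rightarrow> 'a) \<Rightarrow> real) \<Rightarrow> (nat \<Rightarrow> 'a) \<Rightarrow> real" where
  "trunc n G \<omega> = (\<Sum>ws | length ws = n. G (pad ws) * indicator (cylinder ws) \<omega>)"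

lemma finite_words: "finite {ws :: 'a::finite list. length ws = n}"
  using finite_lists_length_eq[of "UNIV :: 'a set" n] by simp

lemma trunc_eq:
  fixes \<omega> :: "nat \<Rightarrow> 'a::finite"
  shows "trunc n G \<omega> = G (pad (map \<omega> [0..<n]))"
proof -
  have "trunc n G \<omega> = (\<Sum>ws | length ws = n. if ws = map \<omega> [0..<n] then G (pad ws) else 0)"
    unfolding trunc_def by (intro sum.cong) (auto simp: cylinder_def indicator_def)
  then show ?thesis by (simp add: finite_words)
qed

lemma trunc_close:
  fixes \<omega> :: "nat \<Rightarrow> 'a::finite"
  assumes "\<And>n \<omega> \<omega>'. (\<And>i. i < n \<Longrightarrow> \<omega> i = \<omega>' i) \<Longrightarrow> \<bar>G \<omega> - G \<omega>'\<bar> \<le> e n"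
  shows "\<bar>G \<omega> - trunc n G \<omega>\<bar> \<le> e n"
  unfolding trunc_eq by (rule assms) (simp add: pad_def)

lemma borel_measurable_trunc [measurable]: "trunc n G \<in> borel_measurable (seq_space :: (nat \<Rightarrow> 'a::finite) measure)"
  unfolding trunc_def[abs_def] by measurable

lemma borel_measurable_modulus:
  fixes G :: "(nat \<Rightarrow> 'a::finite) \<Rightarrow> real"
  assumes G: "\<And>n \<omega> \<omega>'. (\<And>i. i < n \<Longrightarrow> \<omega> i = \<omega>' i) \<Longrightarrow> \<bar>G \<omega> - G \<omega>'\<bar> \<le> e n" and e: "e \<longlonglongrightarrow> 0"
  shows "G \<in> borel_measurable seq_space"
proof (rule borel_measurable_LIMSEQ_real)
  fix \<omega> :: "nat \<Rightarrow> 'a"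
  have "(\<lambda>n. trunc n G \<omega> - G \<omega>) \<longlonglongrightarrow> 0"
    by (rule Lim_null_comparison[OF _ e]) (use trunc_close[of G e, OF G] in \<open>auto simp: abs_minus_commute intro!: always_eventually\<close>)
  then show "(\<lambda>n. trunc n G \<omega>) \<longlonglongrightarrow> G \<omega>" by (rule LIM_zero_cancel)
qed (rule borel_measurable_trunc)

text \<open>The identity is known for cylinders, hence for truncations. The modulus \<open>e\<close>
  makes the truncations converge uniformly to \<open>G\<close>, which is enough for the merely
  finitely additive \<Lambda>.\<close>

lemma fiber_kernel_integral:
  fixes G :: "(nat \<Rightarrow> 'b::finite) \<Rightarrow> real"
  assumes "fiber_functional M \<Lambda>"
    and L[measurable]: "L \<in> M \<rightarrow>\<^sub>M prob_algebra seq_space"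
    and cyl: "\<And>E ws. E \<in> sets M \<Longrightarrow> (\<integral>x. indicator E x * measure (L x) (cylinder ws) \<partial>M) =
        \<Lambda> (\<lambda>z. indicator E (fst z) * indicator (cylinder ws) (snd z))"
    and G: "\<And>n \<omega> \<omega>'. (\<And>i. i < n \<Longrightarrow> \<omega> i = \<omega>' i) \<Longrightarrow> \<bar>G \<omega> - G \<omega>'\<bar> \<le> e n" and e: "e \<longlonglongrightarrow> 0"
    and E: "E \<in> sets M"
  shows "(\<integral>x. indicator E x * (\<integral>\<omega>. G \<omega> \<partial>L x) \<partial>M) = \<Lambda> (\<lambda>z. indicator E (fst z) * G (snd z))"
proof -
  interpret fiber_functional M \<Lambda> by fact
  note [measurable] = E
  have L': "prob_space (L x)" "sets (L x) = sets seq_space" if "x \<in> space M" for x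
    using measurable_space[OF L that] by (auto simp: space_prob_algebra)
  have Gm[measurable]: "G \<in> borel_measurable seq_space" by (rule borel_measurable_modulus[OF G e])
  \<comment> \<open>Agreement on the first 0 letters is no condition, so \<open>e 0\<close> bounds
    the whole oscillation of \<open>G\<close>.\<close>
  define b where "b = \<bar>G (\<lambda>_. undefined)\<bar> + e 0"
  have Gb: "\<bar>G \<omega>\<bar> \<le> b" for \<omega>
    using G[of 0 \<omega> "\<lambda>_. undefined"] by (simp add: b_def)
  have tb: "\<bar>trunc n G \<omega>\<bar> \<le> b" for n \<omega> by (simp add: trunc_eq Gb)
  have Lm: "L \<in> M \<rightarrow>\<^sub>M subprob_algebra seq_space" by (rule measurable_prob_algebraD[OF L])
  have im: "(\<lambda>x. \<integral>\<omega>. g \<omega> \<partial>L x) \<in> borel_measurable M" if "g \<in> borel_measurable seq_space" for g :: "_ \<Rightarrow> real"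
    using integral_measurable_subprob_algebra[OF that] Lm by (rule measurable_compose[rotated])
  have int: "integrable (L x) g" "\<bar>\<integral>\<omega>. g \<omega> \<partial>L x\<bar> \<le> c"
    if x: "x \<in> space M" and g: "g \<in> borel_measurable seq_space" "\<And>\<omega>. \<bar>g \<omega>\<bar> \<le> c" for x and c :: real and g :: "_ \<Rightarrow> real"
  proof -
    interpret Lx: prob_space "L x" by (rule L'[OF x])
    have "g \<in> borel_measurable (L x)" using g(1) L'(2)[OF x] by (simp cong: measurable_cong_sets)
    then show i: "integrable (L x) g"
      using g(2) by (intro Lx.integrable_const_bound[where B=c]) auto
    have "\<bar>\<integral>\<omega>. g \<omega> \<partial>L x\<bar> \<le> (\<integral>\<omega>. \<bar>g \<omega>\<bar> \<partial>L x)" by (rule integral_abs_bound)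
    also have "\<dots> \<le> (\<integral>\<omega>. c \<partial>L x)" by (intro integral_mono integrable_abs i g(2)) simp
    finally show "\<bar>\<integral>\<omega>. g \<omega> \<partial>L x\<bar> \<le> c" by (simp add: Lx.prob_space)
  qed
  have intE: "integrable M (\<lambda>x. indicator E x * (\<integral>\<omega>. g \<omega> \<partial>L x))"
    if g: "g \<in> borel_measurable seq_space" "\<And>\<omega>. \<bar>g \<omega>\<bar> \<le> c" for c :: real and g :: "_ \<Rightarrow> real"
  proof (rule integrable_const_bound[where B=c])
    show "(\<lambda>x. indicator E x * (\<integral>\<omega>. g \<omega> \<partial>L x)) \<in> borel_measurable M"
      using im[OF g(1)] by measurable
    have "0 \<le> c" using g(2)[of undefined] by linarith
    then show "AE x in M. norm (indicator E x * (\<integral>\<omega>. g \<omega> \<partial>L x)) \<le> c"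
      using int(2)[OF _ g] by (auto simp: indicator_def)
  qed
  have tr: "(\<integral>x. indicator E x * (\<integral>\<omega>. trunc n G \<omega> \<partial>L x) \<partial>M) = \<Lambda> (\<lambda>z. indicator E (fst z) * trunc n G (snd z))" for n
  proof -
    have "(\<integral>x. indicator E x * (\<integral>\<omega>. trunc n G \<omega> \<partial>L x) \<partial>M) =
        (\<integral>x. (\<Sum>ws | length ws = n. G (pad ws) * (indicator E x * measure (L x) (cylinder ws))) \<partial>M)"
    proof (rule Bochner_Integration.integral_cong[OF refl])
      fix x assume x: "x \<in> space M"
      have "(\<integral>\<omega>. trunc n G \<omega> \<partial>L x) = (\<Sum>ws | length ws = n. \<integral>\<omega>. G (pad ws) * indicator (cylinder ws) \<omega> \<partial>L x)"
        unfolding trunc_def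
        by (intro Bochner_Integration.integral_sum int(1)[OF x, of _ b])
          (auto simp: indicator_def Gb intro: order_trans[OF abs_ge_zero Gb])
      also have "\<dots> = (\<Sum>ws | length ws = n. G (pad ws) * measure (L x) (cylinder ws))"
        using L'(2)[OF x] by simp
      finally show "indicator E x * (\<integral>\<omega>. trunc n G \<omega> \<partial>L x) =
          (\<Sum>ws | length ws = n. G (pad ws) * (indicator E x * measure (L x) (cylinder ws)))"
        by (simp only: sum_distrib_left mult.left_commute)
    qed
    also have "\<dots> = (\<Sum>ws | length ws = n. G (pad ws) * (\<integral>x. indicator E x * measure (L x) (cylinder ws) \<partial>M))"
    proof (subst Bochner_Integration.integral_sum)
      fix ws :: "'b list"
      have "integrable M (\<lambda>x. indicator E x * (\<integral>\<omega>. indicator (cylinder ws) \<omega> \<partial>L x) :: real)"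
        by (rule intE[of _ 1]) (auto simp: indicator_def)
      then have "integrable M (\<lambda>x. indicator E x * measure (L x) (cylinder ws))"
        using L'(2) by (subst Bochner_Integration.integrable_cong[OF refl]) auto
      then show "integrable M (\<lambda>x. G (pad ws) * (indicator E x * measure (L x) (cylinder ws)))" by simp
    qed simp
    also have "\<dots> = (\<Sum>ws | length ws = n. G (pad ws) * \<Lambda> (\<lambda>z. indicator E (fst z) * indicator (cylinder ws) (snd z)))"
      by (simp only: cyl[OF E])
    also have "\<dots> = \<Lambda> (\<lambda>z. \<Sum>ws | length ws = n. G (pad ws) * (indicator E (fst z) * indicator (cylinder ws) (snd z)))"
      by (subst sum[OF finite_words fiber_bounded_cmult[OF fiber_bounded_indicators]])
        (simp only: cmult[OF fiber_bounded_indicators])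
    also have "(\<lambda>z. \<Sum>ws | length ws = n. G (pad ws) * (indicator E (fst z) * indicator (cylinder ws) (snd z))) =
        (\<lambda>z. indicator E (fst z) * trunc n G (snd z))"
      unfolding trunc_def by (simp only: sum_distrib_left mult.left_commute)
    finally show ?thesis .
  qed
  \<comment> \<open>Truncation costs \<open>e n\<close> on the side of the integral and
    \<open>e n\<close> on the side of \<Lambda>.\<close>
  have "\<bar>(\<integral>x. indicator E x * (\<integral>\<omega>. G \<omega> \<partial>L x) \<partial>M) - \<Lambda> (\<lambda>z. indicator E (fst z) * G (snd z))\<bar> \<le> 2 * e n" for n
  proof -
    have en: "0 \<le> e n" using G[of n undefined undefined] by simp
    have b1: "fiber_bounded M (\<lambda>z. indicator E (fst z))"
      by (rule fiber_bounded_fst[of _ _ 1]) (auto simp: indicator_def)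
    have "\<bar>\<Lambda> (\<lambda>z. indicator E (fst z) * G (snd z)) - \<Lambda> (\<lambda>z. indicator E (fst z) * trunc n G (snd z))\<bar> \<le> e n"
      using trunc_close[of G e, OF G] en
      by (intro dist_le fiber_bounded_mult[OF b1] fiber_bounded_snd[OF Gb] fiber_bounded_snd[OF tb])
        (auto simp: indicator_def)
    moreover have "\<bar>(\<integral>x. indicator E x * (\<integral>\<omega>. G \<omega> \<partial>L x) \<partial>M) - (\<integral>x. indicator E x * (\<integral>\<omega>. trunc n G \<omega> \<partial>L x) \<partial>M)\<bar> \<le> e n"
    proof -
      have le: "\<bar>indicator E x * (\<integral>\<omega>. G \<omega> \<partial>L x) - indicator E x * (\<integral>\<omega>. trunc n G \<omega> \<partial>L x)\<bar> \<le> e n" if x: "x \<in> space M" for x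
      proof -
        have "(\<integral>\<omega>. G \<omega> \<partial>L x) - (\<integral>\<omega>. trunc n G \<omega> \<partial>L x) = (\<integral>\<omega>. G \<omega> - trunc n G \<omega> \<partial>L x)"
          using int(1)[OF x Gm Gb] int(1)[OF x borel_measurable_trunc tb] by simp
        moreover have "\<bar>\<integral>\<omega>. G \<omega> - trunc n G \<omega> \<partial>L x\<bar> \<le> e n"
          using trunc_close[of G e, OF G] by (intro int(2)[OF x]) auto
        ultimately show ?thesis using en by (auto simp: indicator_def)
      qed
      have i: "integrable M (\<lambda>x. indicator E x * (\<integral>\<omega>. G \<omega> \<partial>L x))"
        "integrable M (\<lambda>x. indicator E x * (\<integral>\<omega>. trunc n G \<omega> \<partial>L x))"
        by (rule intE[OF Gm Gb], rule intE[OF borel_measurable_trunc tb])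
      have "\<bar>\<integral>x. indicator E x * (\<integral>\<omega>. G \<omega> \<partial>L x) - indicator E x * (\<integral>\<omega>. trunc n G \<omega> \<partial>L x) \<partial>M\<bar>
          \<le> (\<integral>x. \<bar>indicator E x * (\<integral>\<omega>. G \<omega> \<partial>L x) - indicator E x * (\<integral>\<omega>. trunc n G \<omega> \<partial>L x)\<bar> \<partial>M)"
        by (rule integral_abs_bound)
      also have "\<dots> \<le> (\<integral>x. e n \<partial>M)"
        using i le by (intro integral_mono integrable_abs Bochner_Integration.integrable_diff) auto
      finally show ?thesis using i by (simp add: prob_space)
    qed
    ultimately show ?thesis unfolding tr by linarith
  qed
  moreover have "(\<lambda>n. 2 * e n) \<longlonglongrightarrow> 0" using tendsto_mult_right_zero[OF e, of 2] by simp
  ultimately have "\<bar>(\<integral>x. indicator E x * (\<integral>\<omega>. G \<omega> \<partial>L x) \<partial>M) - \<Lambda> (\<lambda>z. indicator E (fst z) * G (snd z))\<bar> \<le> 0"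
    by (intro LIMSEQ_le_const[of "\<lambda>n. 2 * e n"]) auto
  then show ?thesis by simp
qed

section \<open>Binary digits\<close>

definition binary_value :: "(nat \<Rightarrow> bool) \<Rightarrow> real" where
  "binary_value b = (\<Sum>n. of_bool (b n) * (1/2) ^ Suc n)"

lemma summable_binary: "summable (\<lambda>n. of_bool (b n) * (1/2 :: real) ^ Suc n)"
  by (rule summable_comparison_test'[where g="\<lambda>n. (1/2) ^ Suc n" and N=0])
    (auto simp: summable_Suc_iff intro!: summable_mult summable_geometric)

lemma binary_value_bounds: "0 \<le> binary_value b" "binary_value b \<le> 1"
proof -
  show "0 \<le> binary_value b"
    unfolding binary_value_def by (intro suminf_nonneg summable_binary) auto
  have "binary_value b \<le> (\<Sum>n. (1/2) ^ Suc n)"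
    unfolding binary_value_def using power_half_series
    by (intro suminf_le summable_binary sums_summable) auto
  then show "binary_value b \<le> 1" using sums_unique[OF power_half_series] by simp
qed

lemma binary_value_split:
  "binary_value b = (\<Sum>i<n. of_bool (b i) * (1/2) ^ Suc i) + (1/2) ^ n * binary_value (\<lambda>i. b (i + n))"
proof -
  have "(\<Sum>i. of_bool (b (i + n)) * (1/2 :: real) ^ Suc (i + n)) =
      (\<Sum>i. (1/2) ^ n * (of_bool (b (i + n)) * (1/2) ^ Suc i))"
    by (simp add: power_add mult_ac)
  also have "\<dots> = (1/2) ^ n * binary_value (\<lambda>i. b (i + n))"
    unfolding binary_value_def by (rule suminf_mult[OF summable_binary])
  finally show ?thesis
    using suminf_split_initial_segment[OF summable_binary, of b n] by (simp add: binary_value_def)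
qed

text \<open>After n common digits the values differ by a difference of two tails in [0, 1], scaled
  by \<open>(1/2) ^ n\<close>.\<close>

lemma binary_value_modulus:
  assumes "\<And>i. i < n \<Longrightarrow> b i = b' i"
  shows "\<bar>binary_value b - binary_value b'\<bar> \<le> (1/2) ^ n"
proof -
  have "binary_value b - binary_value b' =
      (1/2) ^ n * (binary_value (\<lambda>i. b (i + n)) - binary_value (\<lambda>i. b' (i + n)))"
    using assms binary_value_split[of b n] binary_value_split[of b' n] by (simp add: algebra_simps)
  moreover have "\<bar>binary_value (\<lambda>i. b (i + n)) - binary_value (\<lambda>i. b' (i + n))\<bar> \<le> 1"
    using binary_value_bounds[of "\<lambda>i. b (i + n)"] binary_value_bounds[of "\<lambda>i. b' (i + n)"] by linarith
  ultimately show ?thesis by (simp add: abs_mult)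
qed

text \<open>Greedy expansion: the map s -> 2s - [s >= 1/2] sends [0, 1] to itself, and t minus its
  first n digits is \<open>(1/2) ^ n\<close> times the n-th iterate. The endpoint 1 is a fixed point
  and gets the digits 1, 1, 1, ...\<close>

lemma binary_value_surj:
  assumes "0 \<le> t" "t \<le> 1"
  shows "\<exists>b. binary_value b = t"
proof -
  define r where "r n = ((\<lambda>s. 2 * s - of_bool (s \<ge> 1/2)) ^^ n) t" for n
  have r: "r 0 = t" "\<And>n. r (Suc n) = 2 * r n - of_bool (r n \<ge> 1/2)" by (auto simp: r_def)
  have r_bounds: "0 \<le> r n \<and> r n \<le> 1" for n
    by (induction n) (use assms in \<open>auto simp: r\<close>)
  have "t - (\<Sum>i<n. of_bool (r i \<ge> 1/2) * (1/2) ^ Suc i) = (1/2) ^ n * r n" for n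
    by (induction n) (auto simp: r algebra_simps)
  then have "\<bar>(\<Sum>i<n. of_bool (r i \<ge> 1/2) * (1/2) ^ Suc i) - t\<bar> \<le> (1/2) ^ n" for n
    using r_bounds[of n] by (subst abs_minus_commute) (auto simp: abs_mult)
  then have "(\<lambda>n. (\<Sum>i<n. of_bool (r i \<ge> 1/2) * (1/2) ^ Suc i) - t) \<longlonglongrightarrow> 0"
    by (intro Lim_null_comparison[OF _ LIMSEQ_realpow_zero[of "1/2"]]) (auto intro!: always_eventually)
  then have "(\<lambda>i. of_bool (r i \<ge> 1/2) * (1/2) ^ Suc i) sums t"
    unfolding sums_def by (rule LIM_zero_cancel)
  then have "binary_value (\<lambda>i. r i \<ge> 1/2) = t"
    unfolding binary_value_def by (rule sums_unique[symmetric])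
  then show ?thesis by auto
qed

text \<open>A letter is a set of coordinates, namely those whose current binary digit is 1. Thus a
  single sequence over the finite alphabet of subsets of \<open>'d\<close> carries the expansions of
  all coordinates at once.\<close>

lemma cantor_parametrization:
  fixes X :: "(real ^ 'd) set"
  assumes "bounded X"
  obtains q :: "(nat \<Rightarrow> 'd set) \<Rightarrow> real ^ 'd" and c
  where "X \<subseteq> range q"
    "\<And>n \<omega> \<omega>'. (\<And>i. i < n \<Longrightarrow> \<omega> i = \<omega>' i) \<Longrightarrow> dist (q \<omega>) (q \<omega>') \<le> c * (1/2) ^ n"
proof -
  obtain R where R: "0 < R" "\<And>x. x \<in> X \<Longrightarrow> norm x \<le> R"
    using assms bounded_pos by metis
  define q :: "(nat \<Rightarrow> 'd set) \<Rightarrow> real ^ 'd"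
    where "q \<omega> = (\<chi> j. 2 * R * binary_value (\<lambda>n. j \<in> \<omega> n) - R)" for \<omega>
  show ?thesis
  \<comment> \<open>Each coordinate ranges over an interval of length 2R and moves by at most 2R
    \<open>(1/2) ^ n\<close>; summing the coordinates bounds the norm.\<close>
  proof (rule that[of q "real CARD('d) * (2 * R)"])
    show "X \<subseteq> range q"
    proof
      fix x assume x: "x \<in> X"
      have "0 \<le> (x $ j + R) / (2 * R)" "(x $ j + R) / (2 * R) \<le> 1" for j
        using R(1) R(2)[OF x] component_le_norm_cart[of x j] by (auto simp: field_simps)
      then have "\<forall>j. \<exists>b. binary_value b = (x $ j + R) / (2 * R)"
        by (blast intro: binary_value_surj)
      then obtain b where b: "\<And>j. binary_value (b j) = (x $ j + R) / (2 * R)" by metis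
      have "q (\<lambda>n. {j. b j n}) = x"
        using R(1) by (simp add: q_def vec_eq_iff b)
      then show "x \<in> range q" by (metis rangeI)
    qed
    fix n and \<omega> \<omega>' :: "nat \<Rightarrow> 'd set" assume eq: "\<And>i. i < n \<Longrightarrow> \<omega> i = \<omega>' i"
    have "dist (q \<omega>) (q \<omega>') \<le> (\<Sum>j\<in>UNIV. \<bar>(q \<omega> - q \<omega>') $ j\<bar>)"
      unfolding dist_norm by (rule norm_le_l1_cart)
    also have "\<dots> \<le> (\<Sum>j\<in>(UNIV :: 'd set). 2 * R * (1/2) ^ n)"
    proof (rule sum_mono)
      fix j :: 'd
      have "(q \<omega> - q \<omega>') $ j = 2 * R * (binary_value (\<lambda>n. j \<in> \<omega> n) - binary_value (\<lambda>n. j \<in> \<omega>' n))"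
        by (simp add: q_def algebra_simps)
      moreover have "\<bar>binary_value (\<lambda>n. j \<in> \<omega> n) - binary_value (\<lambda>n. j \<in> \<omega>' n)\<bar> \<le> (1/2) ^ n"
        by (rule binary_value_modulus) (simp add: eq)
      ultimately show "\<bar>(q \<omega> - q \<omega>') $ j\<bar> \<le> 2 * R * (1/2) ^ n"
        using R(1) by (simp add: abs_mult)
    qed
    finally show "dist (q \<omega>) (q \<omega>') \<le> real CARD('d) * (2 * R) * (1/2) ^ n" by simp
  qed
qed

section \<open>Convex order and kernels\<close>

lemma joint_kernel_measurable:
  assumes [measurable]: "\<kappa> \<in> \<mu> \<rightarrow>\<^sub>M prob_algebra N"
  shows "(\<lambda>x. distr (\<kappa> x) (\<mu> \<Otimes>\<^sub>M N) (Pair x)) \<in> \<mu> \<rightarrow>\<^sub>M prob_algebra (\<mu> \<Otimes>\<^sub>M N)"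
  by measurable

lemma prob_algebra_self: "prob_space \<mu> \<Longrightarrow> \<mu> \<in> space (prob_algebra \<mu>)"
  by (simp add: space_prob_algebra)

lemma
  assumes "prob_space \<mu>" "\<kappa> \<in> \<mu> \<rightarrow>\<^sub>M prob_algebra N"
  shows sets_joint: "sets (joint \<mu> N \<kappa>) = sets (\<mu> \<Otimes>\<^sub>M N)"
    and prob_space_joint: "prob_space (joint \<mu> N \<kappa>)"
  unfolding joint_def
  by (rule sets_bind' prob_space_bind', rule prob_algebra_self[OF assms(1)], rule joint_kernel_measurable[OF assms(2)])+

lemma kernel_prob_space:
  assumes "\<kappa> \<in> \<mu> \<rightarrow>\<^sub>M prob_algebra N" "x \<in> space \<mu>"
  shows "prob_space (\<kappa> x)" "sets (\<kappa> x) = sets N" "space (\<kappa> x) = space N"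
  using measurable_space[OF assms] by (auto simp: space_prob_algebra dest: sets_eq_imp_space_eq)

lemma nn_integral_joint:
  assumes "\<kappa> \<in> \<mu> \<rightarrow>\<^sub>M prob_algebra N" and f: "f \<in> borel_measurable (\<mu> \<Otimes>\<^sub>M N)"
  shows "(\<integral>\<^sup>+z. f z \<partial>joint \<mu> N \<kappa>) = (\<integral>\<^sup>+x. \<integral>\<^sup>+y. f (x, y) \<partial>\<kappa> x \<partial>\<mu>)"
  unfolding joint_def
proof (subst nn_integral_bind[OF f measurable_prob_algebraD[OF joint_kernel_measurable[OF assms(1)]]], intro nn_integral_cong)
  fix x assume x: "x \<in> space \<mu>"
  have "Pair x \<in> \<kappa> x \<rightarrow>\<^sub>M \<mu> \<Otimes>\<^sub>M N"
    using measurable_Pair1'[OF x] kernel_prob_space(2)[OF assms(1) x] by (simp cong: measurable_cong_sets)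
  then show "(\<integral>\<^sup>+z. f z \<partial>distr (\<kappa> x) (\<mu> \<Otimes>\<^sub>M N) (Pair x)) = (\<integral>\<^sup>+y. f (x, y) \<partial>\<kappa> x)"
    using f by (simp add: nn_integral_distr)
qed

lemma integral_joint:
  fixes f :: "_ \<Rightarrow> real"
  assumes \<mu>: "prob_space \<mu>" and \<kappa>: "\<kappa> \<in> \<mu> \<rightarrow>\<^sub>M prob_algebra N" and f: "f \<in> borel_measurable (\<mu> \<Otimes>\<^sub>M N)"
    and b: "\<And>z. z \<in> space (\<mu> \<Otimes>\<^sub>M N) \<Longrightarrow> \<bar>f z\<bar> \<le> b"
  shows "(\<integral>z. f z \<partial>joint \<mu> N \<kappa>) = (\<integral>x. \<integral>y. f (x, y) \<partial>\<kappa> x \<partial>\<mu>)"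
    and "integrable \<mu> (\<lambda>x. \<integral>y. f (x, y) \<partial>\<kappa> x)"
proof -
  have D: "(\<integral>z. f z \<partial>distr (\<kappa> x) (\<mu> \<Otimes>\<^sub>M N) (Pair x)) = (\<integral>y. f (x, y) \<partial>\<kappa> x)" if x: "x \<in> space \<mu>" for x
  proof -
    have "Pair x \<in> \<kappa> x \<rightarrow>\<^sub>M \<mu> \<Otimes>\<^sub>M N"
      using measurable_Pair1'[OF x] kernel_prob_space(2)[OF \<kappa> x] by (simp cong: measurable_cong_sets)
    then show ?thesis using f by (rule integral_distr)
  qed
  note K = measurable_prob_algebraD[OF joint_kernel_measurable[OF \<kappa>]]
  have "AE x in \<mu>. emeasure (distr (\<kappa> x) (\<mu> \<Otimes>\<^sub>M N) (Pair x)) (space (distr (\<kappa> x) (\<mu> \<Otimes>\<^sub>M N) (Pair x))) \<le> ennreal 1"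
  proof (rule AE_I2)
    fix x assume "x \<in> space \<mu>"
    then interpret prob_space "distr (\<kappa> x) (\<mu> \<Otimes>\<^sub>M N) (Pair x)"
      by (rule kernel_prob_space(1)[OF joint_kernel_measurable[OF \<kappa>]])
    show "emeasure (distr (\<kappa> x) (\<mu> \<Otimes>\<^sub>M N) (Pair x)) (space (distr (\<kappa> x) (\<mu> \<Otimes>\<^sub>M N) (Pair x))) \<le> ennreal 1"
      by (simp only: emeasure_space_1) simp
  qed
  from integral_bind[OF f b K prob_space.finite_measure[OF \<mu>] this]
  show "(\<integral>z. f z \<partial>joint \<mu> N \<kappa>) = (\<integral>x. \<integral>y. f (x, y) \<partial>\<kappa> x \<partial>\<mu>)"
    unfolding joint_def using D by (auto intro: Bochner_Integration.integral_cong)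
  have "(\<lambda>x. \<integral>z. f z \<partial>distr (\<kappa> x) (\<mu> \<Otimes>\<^sub>M N) (Pair x)) \<in> borel_measurable \<mu>"
    by (rule measurable_compose[OF K integral_measurable_subprob_algebra[OF f]])
  then have meas: "(\<lambda>x. \<integral>y. f (x, y) \<partial>\<kappa> x) \<in> borel_measurable \<mu>"
    using D by (subst measurable_cong[where g="\<lambda>x. \<integral>z. f z \<partial>distr (\<kappa> x) (\<mu> \<Otimes>\<^sub>M N) (Pair x)"]) auto
  show "integrable \<mu> (\<lambda>x. \<integral>y. f (x, y) \<partial>\<kappa> x)"
  proof (rule finite_measure.integrable_const_bound[OF prob_space.finite_measure[OF \<mu>] _ meas])
    show "AE x in \<mu>. norm (\<integral>y. f (x, y) \<partial>\<kappa> x) \<le> b"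
    proof (rule AE_I2)
      fix x assume x: "x \<in> space \<mu>"
      interpret \<kappa>: prob_space "\<kappa> x" by (rule kernel_prob_space(1)[OF \<kappa> x])
      have bx: "\<bar>f (x, y)\<bar> \<le> b" if "y \<in> space (\<kappa> x)" for y
        using b[of "(x, y)"] x that kernel_prob_space(3)[OF \<kappa> x] by (simp add: space_pair_measure)
      have "(\<lambda>y. f (x, y)) \<in> borel_measurable (\<kappa> x)"
        using f x kernel_prob_space(2)[OF \<kappa> x] by (auto cong: measurable_cong_sets)
      then have "integrable (\<kappa> x) (\<lambda>y. f (x, y))"
        by (intro \<kappa>.integrable_const_bound[where B=b] AE_I2) (auto intro: bx)
      then have "(\<integral>y. \<bar>f (x, y)\<bar> \<partial>\<kappa> x) \<le> (\<integral>y. b \<partial>\<kappa> x)"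
        by (intro integral_mono integrable_abs) (auto intro: bx)
      then have "(\<integral>y. \<bar>f (x, y)\<bar> \<partial>\<kappa> x) \<le> b" by (simp add: \<kappa>.prob_space)
      then show "norm (\<integral>y. f (x, y) \<partial>\<kappa> x) \<le> b"
        unfolding real_norm_def by (rule order_trans[OF integral_abs_bound])
    qed
  qed
qed

lemma AE_joint:
  assumes \<kappa>: "\<kappa> \<in> \<mu> \<rightarrow>\<^sub>M prob_algebra N" and P: "Measurable.pred (\<mu> \<Otimes>\<^sub>M N) P"
    and AE: "AE z in joint \<mu> N \<kappa>. P z"
  shows "AE x in \<mu>. AE y in \<kappa> x. P (x, y)"
proof -
  have "AE x in \<mu>. AE z in distr (\<kappa> x) (\<mu> \<Otimes>\<^sub>M N) (Pair x). P z"
    using AE unfolding joint_def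
    by (subst (asm) AE_bind[OF measurable_prob_algebraD[OF joint_kernel_measurable[OF \<kappa>]] P])
  with AE_space show ?thesis
  proof eventually_elim
    case (elim x)
    have "Pair x \<in> \<kappa> x \<rightarrow>\<^sub>M \<mu> \<Otimes>\<^sub>M N"
      using measurable_Pair1'[OF elim(1)] kernel_prob_space(2)[OF \<kappa> elim(1)] by (simp cong: measurable_cong_sets)
    then show ?case
      using elim(2) P by (subst (asm) AE_distr_iff) auto
  qed
qed

lemma distr_joint_fst:
  assumes \<mu>: "prob_space \<mu>" and \<kappa>: "\<kappa> \<in> \<mu> \<rightarrow>\<^sub>M prob_algebra N"
  shows "distr (joint \<mu> N \<kappa>) \<mu> fst = \<mu>"
proof (rule measure_eqI)
  fix A assume "A \<in> sets (distr (joint \<mu> N \<kappa>) \<mu> fst)"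
  then have A[measurable]: "A \<in> sets \<mu>" by simp
  note [measurable_cong] = sets_joint[OF \<mu> \<kappa>]
  have "emeasure (distr (joint \<mu> N \<kappa>) \<mu> fst) A = (\<integral>\<^sup>+z. indicator A (fst z) \<partial>joint \<mu> N \<kappa>)"
    by (subst nn_integral_distr[symmetric, of fst _ \<mu>]) auto
  also have "\<dots> = (\<integral>\<^sup>+x. \<integral>\<^sup>+y. indicator A x \<partial>\<kappa> x \<partial>\<mu>)"
    by (subst nn_integral_joint[OF \<kappa>]) auto
  also have "\<dots> = (\<integral>\<^sup>+x. indicator A x \<partial>\<mu>)"
    using kernel_prob_space[OF \<kappa>] prob_space.emeasure_space_1 by (intro nn_integral_cong) fastforce
  finally show "emeasure (distr (joint \<mu> N \<kappa>) \<mu> fst) A = emeasure \<mu> A" by simp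
qed simp

lemma joint_distr:
  assumes \<mu>: "prob_space \<mu>" and \<kappa>: "\<kappa> \<in> \<mu> \<rightarrow>\<^sub>M prob_algebra N" and g: "g \<in> N \<rightarrow>\<^sub>M N'"
  shows "joint \<mu> N' (\<lambda>x. distr (\<kappa> x) N' g) = distr (joint \<mu> N \<kappa>) (\<mu> \<Otimes>\<^sub>M N') (\<lambda>(x, y). (x, g y))"
    and "(\<lambda>x. distr (\<kappa> x) N' g) \<in> \<mu> \<rightarrow>\<^sub>M prob_algebra N'"
proof -
  note [measurable] = \<kappa> g
  note [measurable_cong] = sets_joint[OF \<mu> \<kappa>]
  show \<kappa>'[measurable]: "(\<lambda>x. distr (\<kappa> x) N' g) \<in> \<mu> \<rightarrow>\<^sub>M prob_algebra N'"
    by (rule measurable_compose[OF \<kappa> measurable_distr_prob_space[OF g]])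
  show "joint \<mu> N' (\<lambda>x. distr (\<kappa> x) N' g) = distr (joint \<mu> N \<kappa>) (\<mu> \<Otimes>\<^sub>M N') (\<lambda>(x, y). (x, g y))"
  proof (rule measure_eqI)
    show "sets (joint \<mu> N' (\<lambda>x. distr (\<kappa> x) N' g)) = sets (distr (joint \<mu> N \<kappa>) (\<mu> \<Otimes>\<^sub>M N') (\<lambda>(x, y). (x, g y)))"
      by (simp add: sets_joint[OF \<mu> \<kappa>'])
    fix A assume "A \<in> sets (joint \<mu> N' (\<lambda>x. distr (\<kappa> x) N' g))"
    then have A[measurable]: "A \<in> sets (\<mu> \<Otimes>\<^sub>M N')" by (simp add: sets_joint[OF \<mu> \<kappa>'])
    have "emeasure (joint \<mu> N' (\<lambda>x. distr (\<kappa> x) N' g)) A = (\<integral>\<^sup>+z. indicator A z \<partial>joint \<mu> N' (\<lambda>x. distr (\<kappa> x) N' g))"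
      using A by (simp add: sets_joint[OF \<mu> \<kappa>'])
    also have "\<dots> = (\<integral>\<^sup>+x. \<integral>\<^sup>+y. indicator A (x, y) \<partial>distr (\<kappa> x) N' g \<partial>\<mu>)"
      by (subst nn_integral_joint[OF \<kappa>']) auto
    also have "\<dots> = (\<integral>\<^sup>+x. \<integral>\<^sup>+y. indicator A (x, g y) \<partial>\<kappa> x \<partial>\<mu>)"
    proof (intro nn_integral_cong)
      fix x assume x: "x \<in> space \<mu>"
      have "g \<in> \<kappa> x \<rightarrow>\<^sub>M N'" using g kernel_prob_space(2)[OF \<kappa> x] by (simp cong: measurable_cong_sets)
      moreover have "(\<lambda>y. indicator A (x, y) :: ennreal) \<in> borel_measurable N'" using x by measurable
      ultimately show "(\<integral>\<^sup>+y. indicator A (x, y) \<partial>distr (\<kappa> x) N' g) = (\<integral>\<^sup>+y. indicator A (x, g y) \<partial>\<kappa> x)"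
        by (simp add: nn_integral_distr)
    qed
    also have "\<dots> = (\<integral>\<^sup>+z. indicator A (case z of (x, y) \<Rightarrow> (x, g y)) \<partial>joint \<mu> N \<kappa>)"
      by (subst nn_integral_joint[OF \<kappa>]) auto
    also have "\<dots> = (\<integral>\<^sup>+z. indicator A z \<partial>distr (joint \<mu> N \<kappa>) (\<mu> \<Otimes>\<^sub>M N') (\<lambda>(x, y). (x, g y)))"
      by (subst nn_integral_distr) auto
    finally show "emeasure (joint \<mu> N' (\<lambda>x. distr (\<kappa> x) N' g)) A =
        emeasure (distr (joint \<mu> N \<kappa>) (\<mu> \<Otimes>\<^sub>M N') (\<lambda>(x, y). (x, g y))) A"
      by simp
  qed
qed

text \<open>The indicator of a nonempty closed set C is the bounded pointwise limit of max 0 (1 - n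
  dist(., C)), and these functions are n-Lipschitz. Closed sets are stable under intersection and
  generate the Borel sets.\<close>

lemma measure_eqI_lipschitz:
  fixes m m' :: "'a::metric_space measure"
  assumes fin: "finite_measure m" "finite_measure m'" and sets: "sets m = sets borel" "sets m' = sets borel"
    and eq: "\<And>v K. (\<And>z. \<bar>v z\<bar> \<le> 1) \<Longrightarrow> (\<And>y z. \<bar>v y - v z\<bar> \<le> K * dist y z) \<Longrightarrow> integral\<^sup>L m v = integral\<^sup>L m' v"
  shows "m = m'"
proof -
  have closed_lim: "(\<lambda>n. integral\<^sup>L \<nu> (\<lambda>z. max 0 (1 - real n * infdist z C))) \<longlonglongrightarrow> measure \<nu> C"
    if C: "closed C" "C \<noteq> {}" and \<nu>: "finite_measure \<nu>" "sets \<nu> = sets borel" for C :: "'a set" and \<nu>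
  proof -
    interpret finite_measure \<nu> by fact
    note [measurable_cong] = \<nu>(2)
    have [measurable]: "C \<in> sets borel" using C by simp
    have [measurable]: "(\<lambda>z. infdist z C) \<in> borel_measurable borel"
      by (intro borel_measurable_continuous_onI continuous_on_infdist continuous_on_id)
    have "(\<lambda>n. integral\<^sup>L \<nu> (\<lambda>z. max 0 (1 - real n * infdist z C))) \<longlonglongrightarrow> integral\<^sup>L \<nu> (indicator C)"
    proof (rule integral_dominated_convergence[where w="\<lambda>_. 1"])
      show "AE z in \<nu>. (\<lambda>n. max 0 (1 - real n * infdist z C)) \<longlonglongrightarrow> indicator C z"
      proof (rule AE_I2)
        fix z
        show "(\<lambda>n. max 0 (1 - real n * infdist z C)) \<longlonglongrightarrow> indicator C z"
        proof (cases "z \<in> C")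
          case False
          then have pos: "infdist z C > 0" by (rule infdist_pos_not_in_closed[OF C])
          obtain N where N: "1 / infdist z C \<le> real N" using real_arch_simple by blast
          have "max 0 (1 - real n * infdist z C) = 0" if "n \<ge> N" for n
          proof -
            have "1 / infdist z C \<le> real n" using N that by linarith
            then show ?thesis using pos by (simp add: field_simps)
          qed
          then show ?thesis using False by (auto intro!: tendsto_eventually eventually_sequentiallyI[of N])
        qed simp
      qed
      show "AE z in \<nu>. norm (max 0 (1 - real n * infdist z C)) \<le> 1" for n
        by (rule AE_I2) (auto simp: infdist_nonneg)
    qed auto
    then show ?thesis using \<nu>(2) by simp
  qed
  have closed_eq: "measure m C = measure m' C" if C: "closed C" for C
  \<comment> \<open>By convention \<open>infdist\<close> to the empty set is 0, so the approximating
    functions would be constantly 1 there.\<close>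
  proof (cases "C = {}")
    case False
    have "integral\<^sup>L m (\<lambda>z. max 0 (1 - real n * infdist z C)) = integral\<^sup>L m' (\<lambda>z. max 0 (1 - real n * infdist z C))" for n
    proof (rule eq)
      show "\<bar>max 0 (1 - real n * infdist z C)\<bar> \<le> 1" for z by (auto simp: infdist_nonneg)
      fix y z
      have "\<bar>max 0 (1 - real n * infdist y C) - max 0 (1 - real n * infdist z C)\<bar> \<le> \<bar>real n * infdist y C - real n * infdist z C\<bar>"
        by linarith
      also have "\<dots> = real n * \<bar>infdist y C - infdist z C\<bar>" by (simp add: abs_mult flip: right_diff_distrib)
      also have "\<dots> \<le> real n * dist y z" by (intro mult_left_mono infdist_triangle_abs) simp
      finally show "\<bar>max 0 (1 - real n * infdist y C) - max 0 (1 - real n * infdist z C)\<bar> \<le> real n * dist y z" .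
    qed
    with closed_lim[OF C False fin(1) sets(1)] closed_lim[OF C False fin(2) sets(2)]
    show ?thesis by (simp add: LIMSEQ_unique)
  qed simp
  interpret m: finite_measure m by fact
  interpret m': finite_measure m' by fact
  show ?thesis
  proof (rule measure_eqI_generator_eq[where E="Collect closed" and \<Omega>=UNIV and A="\<lambda>_. UNIV"])
    show "Int_stable (Collect (closed :: 'a set \<Rightarrow> bool))" by (auto simp: Int_stable_def)
    show "sets m = sigma_sets UNIV (Collect closed)" "sets m' = sigma_sets UNIV (Collect closed)"
      using sets by (simp_all add: borel_eq_closed)
    show "emeasure m C = emeasure m' C" if "C \<in> Collect closed" for C
      using closed_eq[of C] that by (simp add: m.emeasure_eq_measure m'.emeasure_eq_measure)
  qed auto
qed

text \<open>A convex function \<psi> is squeezed in: -f <= \<psi> on Y and \<psi> <= -u on X. The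
  convex order then gives that the integral of -f under P is at most that of \<psi> under P, hence
  at most that of \<psi> under Q, hence at most that of -u under Q.\<close>

lemma convex_order_duality:
  fixes P Q :: "'a::euclidean_space measure"
  assumes PQ: "P \<preceq>\<^sub>c Q" and P: "prob_space P" "sets P = sets (restrict_space borel Y)"
    and Q: "prob_space Q" "sets Q = sets (restrict_space borel X)"
    and Y: "compact Y" and X: "compact X" "X \<noteq> {}"
    and u: "u \<in> borel_measurable Q" "\<And>z. z \<in> X \<Longrightarrow> \<bar>u z\<bar> \<le> b"
    and f: "f \<in> borel_measurable P" "\<And>y. y \<in> Y \<Longrightarrow> \<bar>f y\<bar> \<le> b'"
    and h: "\<And>y. y \<in> Y \<Longrightarrow> norm (h y) \<le> H"
    and le: "\<And>y z. y \<in> Y \<Longrightarrow> z \<in> X \<Longrightarrow> u z + h y \<bullet> (z - y) \<le> f y"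
  shows "integral\<^sup>L Q u \<le> integral\<^sup>L P f"
proof -
  interpret P: prob_space P by fact
  interpret Q: prob_space Q by fact
  have spP: "space P = Y" and spQ: "space Q = X"
    using sets_eq_imp_space_eq[OF P(2)] sets_eq_imp_space_eq[OF Q(2)] by (simp_all add: space_restrict_space)
  have "Y \<noteq> {}" using P.not_empty spP by simp
  then obtain y0 where "y0 \<in> Y" by auto
  then have H: "0 \<le> H" using h[of y0] norm_ge_zero order_trans by blast
  obtain R where R: "\<And>z. z \<in> X \<Longrightarrow> norm z \<le> R"
    using compact_imp_bounded[OF X(1)] by (auto simp: bounded_iff)
  obtain z0 where z0: "z0 \<in> X" using X by auto
  \<comment> \<open>A conjugate of -u: y -> a v - v \<bullet> y is the highest affine function of
    slope -v lying below -u on X.\<close>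
  define a where "a v = (INF z\<in>X. v \<bullet> z - u z)" for v
  have ip: "\<bar>v \<bullet> z\<bar> \<le> H * R" if "v \<in> cball 0 H" "z \<in> X" for v z
    using Cauchy_Schwarz_ineq2[of v z] mult_mono[of "norm v" H "norm z" R] that R H by auto
  have a_le: "a v \<le> v \<bullet> z - u z" if "v \<in> cball 0 H" "z \<in> X" for v z
    unfolding a_def
  proof (rule cINF_lower[OF _ that(2)])
    show "bdd_below ((\<lambda>z. v \<bullet> z - u z) ` X)"
      using ip[OF that(1)] u(2) by (intro bdd_belowI2[where m="- (H * R) - b"]) (smt (verit))
  qed
  have a_ge: "c \<le> a v" if "\<And>z. z \<in> X \<Longrightarrow> c \<le> v \<bullet> z - u z" for c v
    unfolding a_def using X(2) that by (rule cINF_greatest)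
  \<comment> \<open>The largest convex minorant of \<open>- u\<close> on \<open>X\<close> with slopes bounded by \<open>H\<close>; the bound keeps it finite
    on the whole space.\<close>
  define \<psi> where "\<psi> y = (SUP v\<in>cball 0 H. a v - v \<bullet> y)" for y
  have \<psi>_ge: "a v - v \<bullet> y \<le> \<psi> y" if v: "v \<in> cball 0 H" for v y
    unfolding \<psi>_def
  proof (rule cSUP_upper[OF v])
    show "bdd_above ((\<lambda>v. a v - v \<bullet> y) ` cball 0 H)"
    proof (rule bdd_aboveI2[where M="H * R - u z0 + H * norm y"])
      fix v :: 'a assume v: "v \<in> cball 0 H"
      have "\<bar>v \<bullet> y\<bar> \<le> H * norm y"
        using Cauchy_Schwarz_ineq2[of v y] mult_right_mono[of "norm v" H "norm y"] v by auto
      then show "a v - v \<bullet> y \<le> H * R - u z0 + H * norm y"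
        using a_le[OF v z0] ip[OF v z0] by linarith
    qed
  qed
  have \<psi>_le: "\<psi> y \<le> c" if "\<And>v. v \<in> cball 0 H \<Longrightarrow> a v - v \<bullet> y \<le> c" for y c
    unfolding \<psi>_def using H that by (intro cSUP_least) auto
  have convex: "convex_on UNIV \<psi>"
  proof (rule convex_onI)
    fix t :: real and x y :: 'a assume t: "0 < t" "t < 1"
    show "\<psi> ((1 - t) *\<^sub>R x + t *\<^sub>R y) \<le> (1 - t) * \<psi> x + t * \<psi> y"
    proof (rule \<psi>_le)
      fix v :: 'a assume v: "v \<in> cball 0 H"
      have "a v - v \<bullet> ((1 - t) *\<^sub>R x + t *\<^sub>R y) = (1 - t) * (a v - v \<bullet> x) + t * (a v - v \<bullet> y)"
        by (simp add: inner_add_right algebra_simps)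
      also have "\<dots> \<le> (1 - t) * \<psi> x + t * \<psi> y"
        using t \<psi>_ge[OF v] by (intro add_mono mult_left_mono) auto
      finally show "a v - v \<bullet> ((1 - t) *\<^sub>R x + t *\<^sub>R y) \<le> (1 - t) * \<psi> x + t * \<psi> y" .
    qed
  qed simp
  then have cont: "continuous_on UNIV \<psi>" by (intro convex_on_continuous) auto
  then have \<psi>_borel: "\<psi> \<in> borel_measurable borel" by (rule borel_measurable_continuous_onI)
  have bnd: "\<exists>B. \<forall>z\<in>Z. norm (\<psi> z) \<le> B" if "compact Z" for Z
    using compact_imp_bounded[OF compact_continuous_image[OF continuous_on_subset[OF cont] that]]
    by (auto simp: bounded_iff)
  have "integrable P \<psi>"
    using bnd[OF Y] \<psi>_borel P(2)
    by (auto intro!: P.integrable_const_bound AE_I2 measurable_restrict_space1 simp: spP cong: measurable_cong_sets)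
  moreover have "integrable Q \<psi>"
    using bnd[OF X(1)] \<psi>_borel Q(2)
    by (auto intro!: Q.integrable_const_bound AE_I2 measurable_restrict_space1 simp: spQ cong: measurable_cong_sets)
  moreover have "integrable Q u"
    using u by (intro Q.integrable_const_bound[where B=b] AE_I2) (auto simp: spQ)
  moreover have "integrable P f"
    using f by (intro P.integrable_const_bound[where B=b'] AE_I2) (auto simp: spP)
  \<comment> \<open>Take v = - h y. The hypothesis \<open>le\<close> says that the affine function
    with value - f y at y and slope h y lies below -u on X, so it competes in the supremum.\<close>
  moreover have "- f y \<le> \<psi> y" if y: "y \<in> Y" for y
  proof -
    have "- f y - h y \<bullet> y \<le> a (- h y)"
      using le[OF y] by (intro a_ge) (force simp: inner_diff_right)
    then show ?thesis using \<psi>_ge[of "- h y" y] h[OF y] by simp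
  qed
  moreover have "\<psi> z \<le> - u z" if z: "z \<in> X" for z
    using a_le[OF _ z] by (intro \<psi>_le) force
  moreover have "integral\<^sup>L P \<psi> \<le> integral\<^sup>L Q \<psi>"
    using PQ convex by (auto simp: convex_order_def)
  ultimately have "(\<integral>y. - f y \<partial>P) \<le> integral\<^sup>L P \<psi>" "integral\<^sup>L P \<psi> \<le> integral\<^sup>L Q \<psi>"
    "integral\<^sup>L Q \<psi> \<le> (\<integral>z. - u z \<partial>Q)"
    by (blast intro: integral_mono Bochner_Integration.integrable_minus dest: spP[THEN equalityD1, THEN subsetD] spQ[THEN equalityD1, THEN subsetD])+
  then show ?thesis by simp
qed

text \<open>The envelope used at x1 depends on x1 in an uncontrolled way, but it disappears from the
  conclusion of \<open>convex_order_duality\<close>. What is integrated over x1 is an inequality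
  between two measurable functions.\<close>

lemma ordered_kernels_duality:
  fixes \<mu>1 :: "'a measure" and \<mu>2 \<mu>3 :: "('e::euclidean_space) measure"
  assumes \<mu>1: "prob_space \<mu>1"
    and X2: "compact X2" "sets \<mu>2 = sets (restrict_space borel X2)"
    and X3: "compact X3" "sets \<mu>3 = sets (restrict_space borel X3)"
    and \<kappa>12: "\<kappa>12 \<in> \<mu>1 \<rightarrow>\<^sub>M prob_algebra \<mu>2" and \<kappa>13: "\<kappa>13 \<in> \<mu>1 \<rightarrow>\<^sub>M prob_algebra \<mu>3"
    and order: "AE x1 in \<mu>1. \<kappa>12 x1 \<preceq>\<^sub>c \<kappa>13 x1"
    and u: "u \<in> borel_measurable (\<mu>1 \<Otimes>\<^sub>M \<mu>3)" "\<And>z. \<bar>u z\<bar> \<le> b"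
    and h: "\<And>x. norm (h x) \<le> H"
    and f: "f \<in> borel_measurable (\<mu>1 \<Otimes>\<^sub>M \<mu>2)" "\<And>x. x \<in> space (\<mu>1 \<Otimes>\<^sub>M \<mu>2) \<Longrightarrow> \<bar>f x\<bar> \<le> b'"
    and le: "\<And>x y z. x \<in> space \<mu>1 \<Longrightarrow> y \<in> X2 \<Longrightarrow> z \<in> X3 \<Longrightarrow> u (x, z) + h (x, y) \<bullet> (z - y) \<le> f (x, y)"
  shows "integral\<^sup>L (joint \<mu>1 \<mu>3 \<kappa>13) u \<le> integral\<^sup>L (joint \<mu>1 \<mu>2 \<kappa>12) f"
proof -
  have sp2: "space \<mu>2 = X2" and sp3: "space \<mu>3 = X3"
    using sets_eq_imp_space_eq[OF X2(2)] sets_eq_imp_space_eq[OF X3(2)] by (simp_all add: space_restrict_space)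
  have "(\<integral>x. \<integral>z. u (x, z) \<partial>\<kappa>13 x \<partial>\<mu>1) \<le> (\<integral>x. \<integral>y. f (x, y) \<partial>\<kappa>12 x \<partial>\<mu>1)"
  proof (rule integral_mono_AE)
    show "integrable \<mu>1 (\<lambda>x. \<integral>z. u (x, z) \<partial>\<kappa>13 x)" by (rule integral_joint(2)[OF \<mu>1 \<kappa>13 u])
    show "integrable \<mu>1 (\<lambda>x. \<integral>y. f (x, y) \<partial>\<kappa>12 x)" by (rule integral_joint(2)[OF \<mu>1 \<kappa>12 f])
    show "AE x in \<mu>1. (\<integral>z. u (x, z) \<partial>\<kappa>13 x) \<le> (\<integral>y. f (x, y) \<partial>\<kappa>12 x)"
      using AE_space order
    proof eventually_elim
      case (elim x)
      note P = kernel_prob_space[OF \<kappa>12 elim(1)] and Q = kernel_prob_space[OF \<kappa>13 elim(1)]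
      show ?case
      proof (rule convex_order_duality[OF elim(2) P(1) _ Q(1) _ X2(1) X3(1), where h="\<lambda>y. h (x, y)" and H=H and b=b and b'=b'])
        show "sets (\<kappa>12 x) = sets (restrict_space borel X2)" "sets (\<kappa>13 x) = sets (restrict_space borel X3)"
          using P(2) Q(2) X2(2) X3(2) by simp_all
        show "X3 \<noteq> {}" using prob_space.not_empty[OF Q(1)] Q(3) sp3 by simp
        show "(\<lambda>z. u (x, z)) \<in> borel_measurable (\<kappa>13 x)" "(\<lambda>y. f (x, y)) \<in> borel_measurable (\<kappa>12 x)"
          using u(1) f(1) elim(1) P(2) Q(2) by (auto cong: measurable_cong_sets)
      qed (use u h f le elim sp2 in \<open>auto simp: space_pair_measure\<close>)
    qed
  qed
  then show ?thesis
    by (simp add: integral_joint(1)[OF \<mu>1 \<kappa>13 u] integral_joint(1)[OF \<mu>1 \<kappa>12 f])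
qed

text \<open>The coupling in coded form: \<open>q\<close> of the sequence plays the role of x3. The
  conclusions are weak ones, a Lipschitz test for the law of (x1, x3) and a coordinatewise
  barycentre identity, because these are the constraints whose integrands have a modulus of
  continuity in the sequence.\<close>

lemma ordered_kernels_lift:
  fixes \<mu>1 :: "'a measure" and \<mu>2 \<mu>3 :: "(real ^ 'd) measure"
  assumes \<mu>1: "prob_space \<mu>1"
    and X2: "compact X2" "sets \<mu>2 = sets (restrict_space borel X2)"
    and X3: "compact X3" "sets \<mu>3 = sets (restrict_space borel X3)"
    and \<kappa>12: "\<kappa>12 \<in> \<mu>1 \<rightarrow>\<^sub>M prob_algebra \<mu>2" and \<kappa>13: "\<kappa>13 \<in> \<mu>1 \<rightarrow>\<^sub>M prob_algebra \<mu>3"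
    and order: "AE x1 in \<mu>1. \<kappa>12 x1 \<preceq>\<^sub>c \<kappa>13 x1"
  defines "M \<equiv> joint \<mu>1 \<mu>2 \<kappa>12"
  obtains L :: "'a \<times> (real ^ 'd) \<Rightarrow> (nat \<Rightarrow> 'd set) measure" and q :: "(nat \<Rightarrow> 'd set) \<Rightarrow> real ^ 'd" and B
  where "L \<in> M \<rightarrow>\<^sub>M prob_algebra seq_space" "q \<in> borel_measurable seq_space" "\<And>\<omega>. norm (q \<omega>) \<le> B"
    "\<And>A v K. A \<in> sets \<mu>1 \<Longrightarrow> (\<And>z. \<bar>v z\<bar> \<le> 1) \<Longrightarrow> (\<And>y z. \<bar>v y - v z\<bar> \<le> K * dist y z) \<Longrightarrow>
      (\<integral>(x, \<omega>). indicator A (fst x) * v (q \<omega>) \<partial>joint M seq_space L) =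
      (\<integral>(x, z). indicator A x * v z \<partial>joint \<mu>1 \<mu>3 \<kappa>13)"
    "\<And>E i. E \<in> sets M \<Longrightarrow>
      (\<integral>x. indicator E x * (\<integral>\<omega>. q \<omega> $ i \<partial>L x) \<partial>M) = (\<integral>x. indicator E x * snd x $ i \<partial>M)"
proof -
  have sp2: "space \<mu>2 = X2" and sp3: "space \<mu>3 = X3"
    using sets_eq_imp_space_eq[OF X2(2)] sets_eq_imp_space_eq[OF X3(2)] by (simp_all add: space_restrict_space)
  have M: "prob_space M" "sets M = sets (\<mu>1 \<Otimes>\<^sub>M \<mu>2)"
    unfolding M_def by (rule prob_space_joint[OF \<mu>1 \<kappa>12], rule sets_joint[OF \<mu>1 \<kappa>12])
  have spM: "space M = space \<mu>1 \<times> X2"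
    using sets_eq_imp_space_eq[OF M(2)] by (simp add: space_pair_measure sp2)
  define N where "N = joint \<mu>1 \<mu>3 \<kappa>13"
  have N: "prob_space N" "sets N = sets (\<mu>1 \<Otimes>\<^sub>M \<mu>3)"
    unfolding N_def by (rule prob_space_joint[OF \<mu>1 \<kappa>13], rule sets_joint[OF \<mu>1 \<kappa>13])
  interpret M: prob_space M by fact
  interpret N: prob_space N by fact
  note [measurable_cong] = M(2) N(2) X2(2) X3(2)
  have id2[measurable]: "(\<lambda>x. x) \<in> \<mu>2 \<rightarrow>\<^sub>M borel" and id3[measurable]: "(\<lambda>x. x) \<in> \<mu>3 \<rightarrow>\<^sub>M borel"
    using X2(2) X3(2) by (auto intro: measurable_restrict_space1 cong: measurable_cong_sets)
  obtain q :: "(nat \<Rightarrow> 'd set) \<Rightarrow> real ^ 'd" and c where q_surj: "X3 \<subseteq> range q"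
    and q: "\<And>n \<omega> \<omega>'. (\<And>i. i < n \<Longrightarrow> \<omega> i = \<omega>' i) \<Longrightarrow> dist (q \<omega>) (q \<omega>') \<le> c * (1/2) ^ n"
    using cantor_parametrization[OF compact_imp_bounded[OF X3(1)]] by blast
  \<comment> \<open>A K-Lipschitz function of \<open>q\<close> has modulus K c
    \<open>(1/2) ^ n\<close>; the coordinates of \<open>q\<close> are the case K = 1, which explains
    the factor 1 in \<open>q_comp\<close>.\<close>
  have null: "(\<lambda>n. K * (c * (1/2) ^ n)) \<longlonglongrightarrow> 0" for K
    by (intro tendsto_mult_right_zero LIMSEQ_realpow_zero) auto
  have q_comp: "\<bar>q \<omega> $ i - q \<omega>' $ i\<bar> \<le> 1 * (c * (1/2) ^ n)" if "\<And>i. i < n \<Longrightarrow> \<omega> i = \<omega>' i" for n \<omega> \<omega>' i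
    using order_trans[OF component_le_norm_cart[of "q \<omega> - q \<omega>'" i] q[of n \<omega> \<omega>', unfolded dist_norm]] that by simp
  have q_meas: "q \<in> borel_measurable seq_space"
  proof (rule borel_measurable_euclidean_space[THEN iffD2], rule ballI)
    fix b :: "real ^ 'd" assume "b \<in> Basis"
    then obtain i where b: "b = axis i 1" by (auto simp: Basis_vec_def)
    have "(\<lambda>\<omega>. q \<omega> $ i) \<in> borel_measurable seq_space"
      by (rule borel_measurable_modulus[OF _ null[of 1]], rule q_comp, blast)
    then show "(\<lambda>\<omega>. q \<omega> \<bullet> b) \<in> borel_measurable seq_space"
      by (simp add: b inner_axis)
  qed
  define B where "B = norm (q (\<lambda>_. undefined)) + c"
  have qB: "norm (q \<omega>) \<le> B" for \<omega>
    using q[of 0 \<omega> "\<lambda>_. undefined"] norm_triangle_sub[of "q \<omega>" "q (\<lambda>_. undefined)"]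
    by (simp add: B_def dist_norm)
  obtain R where R: "\<And>y. y \<in> X2 \<Longrightarrow> norm y \<le> R"
    using compact_imp_bounded[OF X2(1)] by (auto simp: bounded_iff)

  \<comment> \<open>The constraints: \<open>u\<close> tests the law of \<open>(x\<^sub>1, x\<^sub>3)\<close>, \<open>h\<close> tests the barycentre of \<open>x\<^sub>3\<close> given \<open>(x\<^sub>1, x\<^sub>2)\<close>.\<close>
  define T where "T u h = (\<lambda>z. (u (fst (fst z), q (snd z)) - integral\<^sup>L N u) + h (fst z) \<bullet> (q (snd z) - snd (fst z)))"
    for u :: "'a \<times> (real ^ 'd) \<Rightarrow> real" and h :: "'a \<times> (real ^ 'd) \<Rightarrow> real ^ 'd"
  \<comment> \<open>The tests are defined and bounded on the whole space, since \<open>q\<close>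
    also takes values outside X3.\<close>
  define U where "U = {u :: 'a \<times> (real ^ 'd) \<Rightarrow> real. u \<in> borel_measurable (\<mu>1 \<Otimes>\<^sub>M borel) \<and> bounded (range u)}"
  define W where "W = {h :: 'a \<times> (real ^ 'd) \<Rightarrow> real ^ 'd. h \<in> borel_measurable M \<and> bounded (range h)}"
  have U_meas: "u \<in> borel_measurable (\<mu>1 \<Otimes>\<^sub>M \<mu>3)" if "u \<in> U" for u
  proof -
    have [measurable]: "u \<in> borel_measurable (\<mu>1 \<Otimes>\<^sub>M borel)" using that by (simp add: U_def)
    have "(\<lambda>z. u (fst z, snd z)) \<in> borel_measurable (\<mu>1 \<Otimes>\<^sub>M \<mu>3)" by measurable
    then show ?thesis by simp
  qed
  have U_int: "integrable N u" if u: "u \<in> U" for u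
  proof -
    obtain b where "\<And>z. \<bar>u z\<bar> \<le> b" using u by (auto simp: U_def bounded_iff)
    then show ?thesis
      using U_meas[OF u] N(2) by (intro N.integrable_const_bound[where B=b] AE_I2) (auto cong: measurable_cong_sets)
  qed
  have T_bdd: "fiber_bounded M (T u h)" if uh: "u \<in> U" "h \<in> W" for u h
  proof -
    obtain b b' where b: "\<And>z. \<bar>u z\<bar> \<le> b" "\<And>z. norm (h z) \<le> b'"
      using uh by (auto simp: U_def W_def bounded_iff)
    show ?thesis
    proof (rule fiber_boundedI[of _ _ "b + \<bar>integral\<^sup>L N u\<bar> + b' * (B + R)"])
      fix x \<omega> assume x: "x \<in> space M"
      have "norm (q \<omega> - snd x) \<le> B + R"
        using R[of "snd x"] x by (intro order_trans[OF norm_triangle_ineq4] add_mono qB) (auto simp: spM)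
      then have "norm (h x) * norm (q \<omega> - snd x) \<le> b' * (B + R)"
        by (intro mult_mono b(2) order_trans[OF norm_ge_zero b(2)] norm_ge_zero)
      then have "\<bar>h x \<bullet> (q \<omega> - snd x)\<bar> \<le> b' * (B + R)"
        by (rule order_trans[OF Cauchy_Schwarz_ineq2])
      then show "\<bar>T u h (x, \<omega>)\<bar> \<le> b + \<bar>integral\<^sup>L N u\<bar> + b' * (B + R)"
        using b(1)[of "(fst x, q \<omega>)"] by (simp add: T_def)
    qed
  qed
  have U0: "(\<lambda>_. 0) \<in> U" and W0: "(\<lambda>_. 0) \<in> W" by (auto simp: U_def W_def)
  define LL where "LL = {T u h | u h. u \<in> U \<and> h \<in> W}"
  have "\<exists>\<Lambda>. fiber_functional M \<Lambda> \<and> (\<forall>F\<in>LL. \<Lambda> F = 0)"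
  proof (rule fiber_functional_extension[OF M(1)])
    show "fiber_bounded M F" if "F \<in> LL" for F
      using that T_bdd by (auto simp: LL_def)
    have "T (\<lambda>_. 0) (\<lambda>_. 0) = (\<lambda>_. 0)" by (simp add: T_def)
    then show "(\<lambda>_. 0) \<in> LL" using U0 W0 unfolding LL_def by (metis (mono_tags, lifting) mem_Collect_eq)
  next
    fix F G assume "F \<in> LL" "G \<in> LL"
    then obtain u h u' h' where F: "F = T u h" "u \<in> U" "h \<in> W" and G: "G = T u' h'" "u' \<in> U" "h' \<in> W"
      by (auto simp: LL_def)
    have "(\<lambda>z. F z + G z) = T (\<lambda>z. u z + u' z) (\<lambda>z. h z + h' z)"
      using U_int[OF F(2)] U_int[OF G(2)] by (auto simp: F G T_def inner_add_left)
    moreover have "(\<lambda>z. u z + u' z) \<in> U" "(\<lambda>z. h z + h' z) \<in> W"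
      using F G by (auto simp: U_def W_def intro!: bounded_plus_comp)
    ultimately show "(\<lambda>z. F z + G z) \<in> LL" by (auto simp: LL_def)
  next
    fix F and k :: real assume "F \<in> LL"
    then obtain u h where F: "F = T u h" "u \<in> U" "h \<in> W"
      by (auto simp: LL_def)
    have "(\<lambda>z. k * F z) = T (\<lambda>z. k * u z) (\<lambda>z. k *\<^sub>R h z)"
      by (auto simp: F T_def algebra_simps)
    moreover have "(\<lambda>z. k * u z) \<in> U" "(\<lambda>z. k *\<^sub>R h z) \<in> W"
      using F bounded_scaleR_comp[of u UNIV k] by (auto simp: U_def W_def intro!: bounded_scaleR_comp)
    ultimately show "(\<lambda>z. k * F z) \<in> LL" by (auto simp: LL_def)
  next
    fix F f b' assume "F \<in> LL" and f: "f \<in> borel_measurable M" "\<And>x. x \<in> space M \<Longrightarrow> \<bar>f x\<bar> \<le> b'"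
      and Ff: "\<And>x \<omega>. x \<in> space M \<Longrightarrow> F (x, \<omega>) \<le> f x"
    then obtain u h where F: "F = T u h" "u \<in> U" "h \<in> W"
      by (auto simp: LL_def)
    obtain b H where b: "\<And>z. \<bar>u z\<bar> \<le> b" "\<And>z. norm (h z) \<le> H"
      using F by (auto simp: U_def W_def bounded_iff)
    let ?c = "integral\<^sup>L N u"
    \<comment> \<open>\<open>T\<close> subtracts the mean of u; moving that constant to the side of
      f brings the claim into the form of the duality lemma.\<close>
    have "integral\<^sup>L N u \<le> (\<integral>x. f x + ?c \<partial>M)"
    proof (rule ordered_kernels_duality[OF \<mu>1 X2 X3 \<kappa>12 \<kappa>13 order U_meas[OF F(2)] b, folded N_def M_def])
      show "(\<lambda>x. f x + ?c) \<in> borel_measurable (\<mu>1 \<Otimes>\<^sub>M \<mu>2)"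
        using f(1) M(2) by (simp cong: measurable_cong_sets)
      show "\<bar>f x + ?c\<bar> \<le> b' + \<bar>?c\<bar>" if "x \<in> space (\<mu>1 \<Otimes>\<^sub>M \<mu>2)" for x
        using f(2)[of x] that sets_eq_imp_space_eq[OF M(2)] by auto
      fix x y z assume x: "x \<in> space \<mu>1" "y \<in> X2" and z: "z \<in> X3"
      \<comment> \<open>Surjectivity onto X3 enters here: a bound over all sequences is a bound at
        every point of X3.\<close>
      then obtain \<omega> where "z = q \<omega>" using q_surj by auto
      then show "u (x, z) + h (x, y) \<bullet> (z - y) \<le> f (x, y) + ?c"
        using Ff[of "(x, y)" \<omega>] x spM by (simp add: F T_def)
    qed
    moreover have "integrable M f"
      using f by (intro M.integrable_const_bound[where B=b'] AE_I2) auto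
    ultimately show "0 \<le> integral\<^sup>L M f" by (simp add: M.prob_space)
  qed
  then obtain \<Lambda> where \<Lambda>: "fiber_functional M \<Lambda>" and zero: "\<And>u h. u \<in> U \<Longrightarrow> h \<in> W \<Longrightarrow> \<Lambda> (T u h) = 0"
    unfolding LL_def by blast
  interpret fiber_functional M \<Lambda> by fact
  obtain L where L[measurable]: "L \<in> M \<rightarrow>\<^sub>M prob_algebra seq_space"
    and cyl: "\<And>E ws. E \<in> sets M \<Longrightarrow> (\<integral>x. indicator E x * measure (L x) (cylinder ws) \<partial>M) =
        \<Lambda> (\<lambda>z. indicator E (fst z) * indicator (cylinder ws) (snd z))"
    by (rule fiber_functional_kernel[OF \<Lambda>]) blast
  show ?thesis
  proof (rule that[OF L q_meas qB])
    fix A and v :: "real ^ 'd \<Rightarrow> real" and K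
    assume A[measurable]: "A \<in> sets \<mu>1" and v: "\<And>z. \<bar>v z\<bar> \<le> 1" "\<And>y z. \<bar>v y - v z\<bar> \<le> K * dist y z"
    \<comment> \<open>The sign of K is not part of the assumption, but a Lipschitz constant has to
      be nonnegative.\<close>
    have K: "\<bar>v y - v z\<bar> \<le> max K 0 * dist y z" for y z
      by (rule order_trans[OF v(2) mult_right_mono]) auto
    have vq: "\<bar>v (q \<omega>) - v (q \<omega>')\<bar> \<le> max K 0 * (c * (1/2) ^ n)" if "\<And>i. i < n \<Longrightarrow> \<omega> i = \<omega>' i" for n \<omega> \<omega>'
      using order_trans[OF K[of "q \<omega>" "q \<omega>'"] mult_left_mono[OF q[of n \<omega> \<omega>']]] that by simp
    have v_cont: "v \<in> borel_measurable borel"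
      by (rule borel_measurable_continuous_onI, rule lipschitz_on_continuous_on[of "max K 0"], rule lipschitz_onI)
        (use K in \<open>auto simp: dist_real_def\<close>)
    define E where "E = fst -` A \<inter> space M"
    have E: "E \<in> sets M" unfolding E_def by measurable
    define u where "u = (\<lambda>(x, z). indicator A x * v z)"
    have u: "u \<in> U"
      unfolding U_def u_def using v(1) v_cont
      by (auto simp: bounded_iff indicator_def intro!: exI[of _ 1])
    have b: "fiber_bounded M (\<lambda>z. indicator E (fst z) * v (q (snd z)))"
      by (rule fiber_boundedI[of _ _ 1]) (use v(1) in \<open>auto simp: indicator_def\<close>)
    \<comment> \<open>With h = 0 only the constraint on the law of (x1, x3) remains.\<close>
    have "0 = \<Lambda> (T u (\<lambda>_. 0))" using zero[OF u W0] by simp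
    also have "\<dots> = \<Lambda> (\<lambda>z. indicator E (fst z) * v (q (snd z)) - integral\<^sup>L N u)"
      by (rule cong[OF T_bdd[OF u W0]]) (auto simp: T_def u_def E_def indicator_def)
    also have "\<dots> = \<Lambda> (\<lambda>z. indicator E (fst z) * v (q (snd z))) - integral\<^sup>L N u"
      by (simp add: diff[OF b fiber_bounded_const] const)
    also have "\<Lambda> (\<lambda>z. indicator E (fst z) * v (q (snd z))) = (\<integral>x. indicator E x * (\<integral>\<omega>. v (q \<omega>) \<partial>L x) \<partial>M)"
      by (rule fiber_kernel_integral[OF \<Lambda> L _ _ null E, symmetric], erule cyl, rule vq, blast)
    also have "\<dots> = (\<integral>x. \<integral>\<omega>. indicator A (fst x) * v (q \<omega>) \<partial>L x \<partial>M)"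
      by (intro Bochner_Integration.integral_cong) (auto simp: E_def indicator_def)
    also have "\<dots> = (\<integral>z. (case z of (x, \<omega>) \<Rightarrow> indicator A (fst x) * v (q \<omega>)) \<partial>joint M seq_space L)"
    proof (subst integral_joint(1)[OF M(1) L, where b=1])
      show "(\<lambda>z. case z of (x, \<omega>) \<Rightarrow> indicator A (fst x) * v (q \<omega>)) \<in> borel_measurable (M \<Otimes>\<^sub>M seq_space)"
        using v_cont q_meas by measurable
    qed (use v(1) in \<open>auto simp: indicator_def\<close>)
    finally show "(\<integral>(x, \<omega>). indicator A (fst x) * v (q \<omega>) \<partial>joint M seq_space L) =
        (\<integral>(x, z). indicator A x * v z \<partial>joint \<mu>1 \<mu>3 \<kappa>13)"
      by (simp add: N_def u_def)
  next
    fix E i assume E[measurable]: "E \<in> sets M"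
    \<comment> \<open>Testing with a basis vector on \<open>E\<close> isolates the i-th coordinate
      of the barycentre constraint.\<close>
    define h :: "'a \<times> (real ^ 'd) \<Rightarrow> real ^ 'd" where "h x = indicator E x *\<^sub>R axis i 1" for x
    have h: "h \<in> W"
      unfolding W_def h_def by (auto simp: bounded_iff indicator_def intro!: exI[of _ 1])
    have b1: "fiber_bounded M (\<lambda>z. indicator E (fst z) * q (snd z) $ i)"
      using order_trans[OF component_le_norm_cart qB] order_trans[OF norm_ge_zero qB]
      by (intro fiber_boundedI[of _ _ B]) (auto simp: indicator_def)
    have bs: "\<bar>indicator E x * snd x $ i\<bar> \<le> \<bar>R\<bar>" if "x \<in> space M" for x
    proof -
      have "snd x \<in> X2" using that by (auto simp: spM)
      then have "\<bar>snd x $ i\<bar> \<le> R" by (intro order_trans[OF component_le_norm_cart R])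
      from this order_trans[OF abs_ge_zero this] show ?thesis by (simp add: indicator_def)
    qed
    have "0 = \<Lambda> (T (\<lambda>_. 0) h)" using zero[OF U0 h] by simp
    also have "T (\<lambda>_. 0) h = (\<lambda>z. indicator E (fst z) * q (snd z) $ i - indicator E (fst z) * snd (fst z) $ i)"
      by (auto simp: T_def h_def indicator_def inner_axis' inner_diff_right)
    also have "\<Lambda> \<dots> = \<Lambda> (\<lambda>z. indicator E (fst z) * q (snd z) $ i) - \<Lambda> (\<lambda>z. indicator E (fst z) * snd (fst z) $ i)"
      by (rule diff[OF b1 fiber_bounded_fst[OF bs]])
    also have "\<Lambda> (\<lambda>z. indicator E (fst z) * snd (fst z) $ i) = (\<integral>x. indicator E x * snd x $ i \<partial>M)"
    proof (rule marginal[OF _ bs])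
      have "(\<lambda>y. y $ i) \<in> borel_measurable borel" by (intro borel_measurable_continuous_onI continuous_intros)
      then have [measurable]: "(\<lambda>y. y $ i) \<in> borel_measurable \<mu>2" by (rule measurable_compose[OF id2])
      show "(\<lambda>x. indicator E x * snd x $ i) \<in> borel_measurable M" by measurable
    qed
    also have "\<Lambda> (\<lambda>z. indicator E (fst z) * q (snd z) $ i) = (\<integral>x. indicator E x * (\<integral>\<omega>. q \<omega> $ i \<partial>L x) \<partial>M)"
      by (rule fiber_kernel_integral[OF \<Lambda> L _ _ null E, symmetric], erule cyl, rule q_comp, blast)
    finally show "(\<integral>x. indicator E x * (\<integral>\<omega>. q \<omega> $ i \<partial>L x) \<partial>M) = (\<integral>x. indicator E x * snd x $ i \<partial>M)"
      by simp
  qed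
qed

text \<open>Composes two successive disintegrations into one over the first coordinate, which is the
  form that the condition for i = 1 of a martingale coupling of three marginals requires.\<close>

lemma joint_assoc:
  assumes \<mu>: "prob_space \<mu>" and \<kappa>'[measurable]: "\<kappa>' \<in> \<mu> \<rightarrow>\<^sub>M prob_algebra N"
    and \<kappa>[measurable]: "\<kappa> \<in> \<mu> \<Otimes>\<^sub>M N \<rightarrow>\<^sub>M prob_algebra R"
  defines "K \<equiv> \<lambda>x. joint (\<kappa>' x) R (\<lambda>y. \<kappa> (x, y))"
  shows "K \<in> \<mu> \<rightarrow>\<^sub>M prob_algebra (N \<Otimes>\<^sub>M R)"
    and "distr (joint (joint \<mu> N \<kappa>') R \<kappa>) (\<mu> \<Otimes>\<^sub>M (N \<Otimes>\<^sub>M R)) (\<lambda>((x, y), z). (x, y, z)) = joint \<mu> (N \<Otimes>\<^sub>M R) K"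
proof -
  note s = sets_joint[OF \<mu> \<kappa>']
  have \<kappa>J[measurable]: "\<kappa> \<in> joint \<mu> N \<kappa>' \<rightarrow>\<^sub>M prob_algebra R"
    using \<kappa> s by (simp cong: measurable_cong_sets)
  \<comment> \<open>Inside \<open>K\<close> the middle space is the measure \<kappa>' x, which
    varies with x. \<open>K'\<close> has the fixed space \<open>N\<close> in its place; it is the
    same kernel, and its measurability follows from the rule for composed kernels.\<close>
  define K' where "K' x = \<kappa>' x \<bind> (\<lambda>y. distr (\<kappa> (x, y)) (N \<Otimes>\<^sub>M R) (Pair y))" for x
  have K_eq: "K x = K' x" if x: "x \<in> space \<mu>" for x
    unfolding K_def K'_def joint_def
    by (intro bind_cong distr_cong sets_pair_measure_cong refl kernel_prob_space(2)[OF \<kappa>' x])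
  have "K' \<in> \<mu> \<rightarrow>\<^sub>M prob_algebra (N \<Otimes>\<^sub>M R)"
    unfolding K'_def[abs_def]
  proof (rule measurable_bind_prob_space2[OF \<kappa>'])
    show "(\<lambda>(x, y). distr (\<kappa> (x, y)) (N \<Otimes>\<^sub>M R) (Pair y)) \<in> \<mu> \<Otimes>\<^sub>M N \<rightarrow>\<^sub>M prob_algebra (N \<Otimes>\<^sub>M R)"
      unfolding split_beta prod.collapse by (rule measurable_distr_prob_space2[OF \<kappa>]) measurable
  qed
  then show K: "K \<in> \<mu> \<rightarrow>\<^sub>M prob_algebra (N \<Otimes>\<^sub>M R)"
    using measurable_cong[of \<mu> K K' "prob_algebra (N \<Otimes>\<^sub>M R)"] K_eq by blast
  note [measurable_cong] =
    trans[OF sets_joint[OF prob_space_joint[OF \<mu> \<kappa>'] \<kappa>J] sets_pair_measure_cong[OF s refl]] s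
  let ?T = "\<lambda>p. (fst (fst p), snd (fst p), snd p)"
  have "distr (joint (joint \<mu> N \<kappa>') R \<kappa>) (\<mu> \<Otimes>\<^sub>M (N \<Otimes>\<^sub>M R)) ?T = joint \<mu> (N \<Otimes>\<^sub>M R) K"
    (is "?l = ?r")
  proof (rule measure_eqI)
    show "sets ?l = sets ?r" by (simp add: sets_joint[OF \<mu> K])
    fix A assume "A \<in> sets ?l"
    then have A[measurable]: "A \<in> sets (\<mu> \<Otimes>\<^sub>M (N \<Otimes>\<^sub>M R))" by simp
    have m: "(\<lambda>z. \<integral>\<^sup>+c. indicator A (fst z, snd z, c) \<partial>\<kappa> z) \<in> borel_measurable (\<mu> \<Otimes>\<^sub>M N)"
      by (rule nn_integral_measurable_subprob_algebra2[where N=R])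
        (use measurable_prob_algebraD[OF \<kappa>] in measurable)
    have "emeasure ?l A = (\<integral>\<^sup>+z. indicator A z \<partial>?l)"
      using A by simp
    also have "\<dots> = (\<integral>\<^sup>+z. indicator A (?T z) \<partial>joint (joint \<mu> N \<kappa>') R \<kappa>)"
      by (rule nn_integral_distr) simp_all
    also have "\<dots> = (\<integral>\<^sup>+z. \<integral>\<^sup>+c. indicator A (fst z, snd z, c) \<partial>\<kappa> z \<partial>joint \<mu> N \<kappa>')"
      by (subst nn_integral_joint[OF \<kappa>J]) (auto simp: split_beta)
    also have "\<dots> = (\<integral>\<^sup>+x. \<integral>\<^sup>+y. \<integral>\<^sup>+c. indicator A (x, y, c) \<partial>\<kappa> (x, y) \<partial>\<kappa>' x \<partial>\<mu>)"
      by (subst nn_integral_joint[OF \<kappa>' m]) simp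
    also have "\<dots> = (\<integral>\<^sup>+x. \<integral>\<^sup>+z. indicator A (x, z) \<partial>K x \<partial>\<mu>)"
    proof (rule nn_integral_cong)
      fix x assume x: "x \<in> space \<mu>"
      have "(\<lambda>y. \<kappa> (x, y)) \<in> N \<rightarrow>\<^sub>M prob_algebra R" using x by measurable
      then have "(\<lambda>y. \<kappa> (x, y)) \<in> \<kappa>' x \<rightarrow>\<^sub>M prob_algebra R"
        using kernel_prob_space(2)[OF \<kappa>' x] by (simp cong: measurable_cong_sets)
      moreover have "(\<lambda>z. indicator A (x, z) :: ennreal) \<in> borel_measurable (N \<Otimes>\<^sub>M R)" using x by measurable
      then have "(\<lambda>z. indicator A (x, z) :: ennreal) \<in> borel_measurable (\<kappa>' x \<Otimes>\<^sub>M R)"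
        using sets_pair_measure_cong[OF kernel_prob_space(2)[OF \<kappa>' x] refl, of R] by (simp cong: measurable_cong_sets)
      ultimately show "(\<integral>\<^sup>+y. \<integral>\<^sup>+c. indicator A (x, y, c) \<partial>\<kappa> (x, y) \<partial>\<kappa>' x) = (\<integral>\<^sup>+z. indicator A (x, z) \<partial>K x)"
        unfolding K_def by (simp add: nn_integral_joint)
    qed
    also have "\<dots> = (\<integral>\<^sup>+z. indicator A z \<partial>?r)"
      by (rule nn_integral_joint[OF K, symmetric]) measurable
    finally show "emeasure ?l A = emeasure ?r A"
      using A by (simp add: sets_joint[OF \<mu> K])
  qed
  then show "distr (joint (joint \<mu> N \<kappa>') R \<kappa>) (\<mu> \<Otimes>\<^sub>M (N \<Otimes>\<^sub>M R)) (\<lambda>((x, y), z). (x, y, z)) =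
      joint \<mu> (N \<Otimes>\<^sub>M R) K"
    by (simp only: case_prod_unfold)
qed

theorem lemma2p4:
  fixes X1 X2 X3 :: "(real ^ 'd) set"
    and \<mu>1 \<mu>2 \<mu>3 :: "(real ^ 'd) measure"
    and \<kappa>12 \<kappa>13 :: "(real ^ 'd) \<Rightarrow> (real ^ 'd) measure"
    and \<pi>12 \<pi>13 :: "((real ^ 'd) \<times> (real ^ 'd)) measure"
  assumes "compact X1" and "compact X2" and "compact X3"
    and "\<mu>1 \<in> borel_probs X1" and "\<mu>2 \<in> borel_probs X2" and "\<mu>3 \<in> borel_probs X3"
    and "\<mu>1 \<preceq>\<^sub>c \<mu>2" and "\<mu>2 \<preceq>\<^sub>c \<mu>3"
    and "\<kappa>12 \<in> \<mu>1 \<rightarrow>\<^sub>M prob_algebra \<mu>2" and "\<kappa>13 \<in> \<mu>1 \<rightarrow>\<^sub>M prob_algebra \<mu>3"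
    and "\<pi>12 = joint \<mu>1 \<mu>2 \<kappa>12" and "\<pi>12 \<in> martingale_couplings2 \<mu>1 \<mu>2"
    and "\<pi>13 = joint \<mu>1 \<mu>3 \<kappa>13" and "\<pi>13 \<in> martingale_couplings2 \<mu>1 \<mu>3"
    and "AE x1 in \<mu>1. \<kappa>12 x1 \<preceq>\<^sub>c \<kappa>13 x1"
  shows "\<exists>\<pi>123 \<in> martingale_couplings3 \<mu>1 \<mu>2 \<mu>3.
    Proj12 \<mu>1 \<mu>2 \<pi>123 = \<pi>12 \<and> Proj13 \<mu>1 \<mu>3 \<pi>123 = \<pi>13"
proof -
  note \<kappa>12 = \<open>\<kappa>12 \<in> \<mu>1 \<rightarrow>\<^sub>M prob_algebra \<mu>2\<close> and \<kappa>13 = \<open>\<kappa>13 \<in> \<mu>1 \<rightarrow>\<^sub>M prob_algebra \<mu>3\<close>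
  have \<mu>1: "prob_space \<mu>1" and \<mu>2: "prob_space \<mu>2" "sets \<mu>2 = sets (restrict_space borel X2)"
    and \<mu>3: "prob_space \<mu>3" "sets \<mu>3 = sets (restrict_space borel X3)"
    using assms by (auto simp: borel_probs_def space_prob_algebra)
  have sp2: "space \<mu>2 = X2" and sp3: "space \<mu>3 = X3"
    using sets_eq_imp_space_eq[OF \<mu>2(2)] sets_eq_imp_space_eq[OF \<mu>3(2)] by (simp_all add: space_restrict_space)
  have \<pi>12: "prob_space \<pi>12" and s12: "sets \<pi>12 = sets (\<mu>1 \<Otimes>\<^sub>M \<mu>2)"
    unfolding assms by (rule prob_space_joint[OF \<mu>1 \<kappa>12], rule sets_joint[OF \<mu>1 \<kappa>12])
  have \<pi>13: "prob_space \<pi>13" and s13: "sets \<pi>13 = sets (\<mu>1 \<Otimes>\<^sub>M \<mu>3)"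
    unfolding assms by (rule prob_space_joint[OF \<mu>1 \<kappa>13], rule sets_joint[OF \<mu>1 \<kappa>13])
  have X3[measurable]: "X3 \<in> sets borel" using assms(3) by (simp add: compact_imp_closed)

  obtain L :: "(real ^ 'd) \<times> (real ^ 'd) \<Rightarrow> (nat \<Rightarrow> 'd set) measure" and q B
    where L: "L \<in> \<pi>12 \<rightarrow>\<^sub>M prob_algebra seq_space" and q[measurable]: "q \<in> borel_measurable seq_space"
      and qB: "\<And>\<omega>. norm (q \<omega>) \<le> B"
      and test: "\<And>A v K. A \<in> sets \<mu>1 \<Longrightarrow> (\<And>z. \<bar>v z\<bar> \<le> 1) \<Longrightarrow> (\<And>y z. \<bar>v y - v z\<bar> \<le> K * dist y z) \<Longrightarrow>
      (\<integral>(x, \<omega>). indicator A (fst x) * v (q \<omega>) \<partial>joint \<pi>12 seq_space L) = (\<integral>(x, z). indicator A x * v z \<partial>\<pi>13)"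
      and bary: "\<And>E i. E \<in> sets \<pi>12 \<Longrightarrow>
      (\<integral>x. indicator E x * (\<integral>\<omega>. q \<omega> $ i \<partial>L x) \<partial>\<pi>12) = (\<integral>x. indicator E x * snd x $ i \<partial>\<pi>12)"
    using ordered_kernels_lift[OF \<mu>1 assms(2) \<mu>2(2) assms(3) \<mu>3(2) \<kappa>12 \<kappa>13 assms(15), folded assms(11,13)]
    by blast
  define P where "P = joint \<pi>12 seq_space L"
  have P: "prob_space P" and sP: "sets P = sets (\<pi>12 \<Otimes>\<^sub>M seq_space)"
    unfolding P_def by (rule prob_space_joint[OF \<pi>12 L], rule sets_joint[OF \<pi>12 L])
  interpret P: prob_space P by fact
  interpret \<pi>12: prob_space \<pi>12 by fact
  interpret \<pi>13: prob_space \<pi>13 by fact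
  note [measurable_cong] = s12 s13 sP
  have id3[measurable]: "(\<lambda>x. x) \<in> \<mu>3 \<rightarrow>\<^sub>M borel" and id2[measurable]: "(\<lambda>x. x) \<in> \<mu>2 \<rightarrow>\<^sub>M borel"
    using \<mu>2(2) \<mu>3(2) by (auto intro: measurable_restrict_space1 cong: measurable_cong_sets)

  \<comment> \<open>The law of (x1, x3)\<close>
  have law: "(\<integral>\<^sup>+z. indicator A (fst (fst z)) * indicator C (q (snd z)) \<partial>P) =
      (\<integral>\<^sup>+z. indicator A (fst z) * indicator C (snd z) \<partial>\<pi>13)"
    if A[measurable]: "A \<in> sets \<mu>1" and C[measurable]: "C \<in> sets borel" for A C
  proof -
    \<comment> \<open>Restricting to x1 in A and projecting to the third coordinate leaves two
      finite measures on the whole space, which Lipschitz tests can compare.\<close>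
    define m where "m = distr (density P (\<lambda>z. ennreal (indicator A (fst (fst z))))) borel (\<lambda>z. q (snd z))"
    define m' where "m' = distr (density \<pi>13 (\<lambda>z. ennreal (indicator A (fst z)))) borel snd"
    have [measurable]: "snd \<in> \<pi>13 \<rightarrow>\<^sub>M borel"
      using measurable_compose[OF measurable_snd id3, of \<mu>1] s13 by (simp cong: measurable_cong_sets)
    have "m = m'"
    proof (rule measure_eqI_lipschitz)
      have fin: "finite_measure (density Q f)"
        if "prob_space Q" "f \<in> borel_measurable Q" "\<And>z. f z \<le> 1" for Q :: "'c measure" and f
      proof (rule finite_measureI)
        have "emeasure (density Q f) (space (density Q f)) \<le> (\<integral>\<^sup>+z. 1 \<partial>Q)"
          by (subst emeasure_density[OF that(2)], simp, intro nn_integral_mono)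
            (use that(3) in \<open>simp add: indicator_def\<close>)
        then show "emeasure (density Q f) (space (density Q f)) \<noteq> \<infinity>"
          using prob_space.emeasure_space_1[OF that(1)] by (auto simp: top_unique)
      qed
      show "finite_measure m" unfolding m_def
        by (intro finite_measure.finite_measure_distr fin P) (auto simp: indicator_def)
      show "finite_measure m'" unfolding m'_def
        by (intro finite_measure.finite_measure_distr fin \<pi>13) (auto simp: indicator_def)
      fix v :: "real ^ 'd \<Rightarrow> real" and K
      assume v: "\<And>z. \<bar>v z\<bar> \<le> 1" "\<And>y z. \<bar>v y - v z\<bar> \<le> K * dist y z"
      have [measurable]: "v \<in> borel_measurable borel"
      proof (rule borel_measurable_continuous_onI, rule lipschitz_on_continuous_on[of "max K 0"], rule lipschitz_onI)
        show "dist (v y) (v z) \<le> max K 0 * dist y z" for y z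
          using order_trans[OF v(2)[of y z] mult_right_mono[OF max.cobounded1[of K 0] zero_le_dist]]
          by (simp add: dist_real_def)
      qed simp
      have "integral\<^sup>L m v = (\<integral>z. indicator A (fst (fst z)) * v (q (snd z)) \<partial>P)"
        unfolding m_def by (subst integral_distr, measurable, subst integral_density) auto
      also have "\<dots> = (\<integral>z. indicator A (fst z) * v (snd z) \<partial>\<pi>13)"
        using test[OF A v] by (simp only: P_def case_prod_unfold)
      also have "\<dots> = integral\<^sup>L m' v"
        unfolding m'_def by (subst integral_distr, measurable, subst integral_density) auto
      finally show "integral\<^sup>L m v = integral\<^sup>L m' v" .
    qed (auto simp: m_def m'_def)
    then have "(\<integral>\<^sup>+y. indicator C y \<partial>m) = (\<integral>\<^sup>+y. indicator C y \<partial>m')" by simp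
    also have "(\<integral>\<^sup>+y. indicator C y \<partial>m) = (\<integral>\<^sup>+z. indicator A (fst (fst z)) * indicator C (q (snd z)) \<partial>P)"
      unfolding m_def by (subst nn_integral_distr) (simp_all add: nn_integral_density ennreal_indicator)
    also have "(\<integral>\<^sup>+y. indicator C y \<partial>m') = (\<integral>\<^sup>+z. indicator A (fst z) * indicator C (snd z) \<partial>\<pi>13)"
      unfolding m'_def by (subst nn_integral_distr) (simp_all add: nn_integral_density ennreal_indicator)
    finally show ?thesis .
  qed
  have qX3: "AE z in P. q (snd z) \<in> X3"
  proof -
    \<comment> \<open>The complement of X3 has no mass under the third marginal of
      \<open>\<pi>13\<close>, and \<open>law\<close> carries this over to \<open>P\<close>.\<close>
    have "(\<integral>\<^sup>+z. indicator (- X3) (q (snd z)) \<partial>P) = (\<integral>\<^sup>+z. indicator (space \<mu>1) (fst (fst z)) * indicator (- X3) (q (snd z)) \<partial>P)"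
      using sets_eq_imp_space_eq[OF sP] sets_eq_imp_space_eq[OF s12]
      by (intro nn_integral_cong) (auto simp: space_pair_measure indicator_def)
    also have "\<dots> = (\<integral>\<^sup>+z. indicator (space \<mu>1) (fst z) * indicator (- X3) (snd z) \<partial>\<pi>13)"
      by (rule law) auto
    also have "\<dots> = (\<integral>\<^sup>+z. 0 \<partial>\<pi>13)"
      using sets_eq_imp_space_eq[OF s13] by (intro nn_integral_cong) (auto simp: space_pair_measure sp3)
    finally have "(\<integral>\<^sup>+z. indicator (- X3) (q (snd z)) \<partial>P) = 0" by simp
    then have "AE z in P. (indicator (- X3) (q (snd z)) :: ennreal) = 0"
      by (subst (asm) nn_integral_0_iff_AE) auto
    then show ?thesis by eventually_elim (auto simp: indicator_def split: if_splits)
  qed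

  \<comment> \<open>Decoding sequences into points of X3\<close>
  obtain z0 where z0: "z0 \<in> X3" using prob_space.not_empty[OF \<mu>3(1)] sp3 by auto
  \<comment> \<open>The range of \<open>q\<close> is larger than \<open>X3\<close>, but almost surely \<open>g\<close> and \<open>q\<close> agree.\<close>
  define g where "g \<omega> = (if q \<omega> \<in> X3 then q \<omega> else z0)" for \<omega>
  have g[measurable]: "g \<in> seq_space \<rightarrow>\<^sub>M \<mu>3"
  proof -
    have "g \<in> seq_space \<rightarrow>\<^sub>M restrict_space borel X3"
      by (rule measurable_restrict_space2) (use z0 in \<open>auto simp: g_def[abs_def]\<close>)
    then show ?thesis using \<mu>3(2) by (simp cong: measurable_cong_sets)
  qed
  define \<kappa> where "\<kappa> x = distr (L x) \<mu>3 g" for x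
  note joint_\<kappa> = joint_distr[OF \<pi>12 L g, folded P_def \<kappa>_def]
  have \<kappa>[measurable]: "\<kappa> \<in> \<mu>1 \<Otimes>\<^sub>M \<mu>2 \<rightarrow>\<^sub>M prob_algebra \<mu>3"
    using joint_\<kappa>(2) s12 by (simp add: \<kappa>_def[abs_def] cong: measurable_cong_sets)
  define \<pi> where "\<pi> = distr P (\<mu>1 \<Otimes>\<^sub>M (\<mu>2 \<Otimes>\<^sub>M \<mu>3)) (\<lambda>z. (fst (fst z), snd (fst z), g (snd z)))"
  have [measurable_cong]: "sets \<pi> = sets (\<mu>1 \<Otimes>\<^sub>M (\<mu>2 \<Otimes>\<^sub>M \<mu>3))" by (simp add: \<pi>_def)
  have P12: "Proj12 \<mu>1 \<mu>2 \<pi> = \<pi>12"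
  proof -
    have "Proj12 \<mu>1 \<mu>2 \<pi> = distr P (\<mu>1 \<Otimes>\<^sub>M \<mu>2) fst"
      unfolding Proj12_def \<pi>_def by (subst distr_distr) (auto simp: comp_def case_prod_unfold)
    also have "\<dots> = distr P \<pi>12 fst" by (rule distr_cong) (auto simp: s12)
    finally show ?thesis unfolding P_def distr_joint_fst[OF \<pi>12 L] .
  qed
  have P13: "Proj13 \<mu>1 \<mu>3 \<pi> = \<pi>13"
  proof -
    have eq: "Proj13 \<mu>1 \<mu>3 \<pi> = distr P (\<mu>1 \<Otimes>\<^sub>M \<mu>3) (\<lambda>z. (fst (fst z), g (snd z)))"
      unfolding Proj13_def \<pi>_def by (subst distr_distr) (auto simp: comp_def case_prod_unfold)
    have rect: "emeasure (distr P (\<mu>1 \<Otimes>\<^sub>M \<mu>3) (\<lambda>z. (fst (fst z), g (snd z)))) (A \<times> C) = emeasure \<pi>13 (A \<times> C)"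
      if A[measurable]: "A \<in> sets \<mu>1" and C[measurable]: "C \<in> sets \<mu>3" for A C
    proof -
      \<comment> \<open>X3 is Borel, so a measurable subset of X3 is Borel in the whole space, as
        \<open>law\<close> requires.\<close>
      have C': "C \<in> sets borel"
        using C \<mu>3(2) by (auto simp: sets_restrict_space)
      have "emeasure (distr P (\<mu>1 \<Otimes>\<^sub>M \<mu>3) (\<lambda>z. (fst (fst z), g (snd z)))) (A \<times> C) =
          (\<integral>\<^sup>+z. indicator A (fst (fst z)) * indicator C (g (snd z)) \<partial>P)"
        by (subst nn_integral_indicator[symmetric], measurable, subst nn_integral_distr)
          (auto simp: indicator_times)
      also have "\<dots> = (\<integral>\<^sup>+z. indicator A (fst (fst z)) * indicator C (q (snd z)) \<partial>P)"
        using qX3 by (intro nn_integral_cong_AE, eventually_elim) (simp add: g_def)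
      also have "\<dots> = (\<integral>\<^sup>+z. indicator A (fst z) * indicator C (snd z) \<partial>\<pi>13)"
        by (rule law[OF A C'])
      also have "\<dots> = (\<integral>\<^sup>+z. indicator (A \<times> C) z \<partial>\<pi>13)"
        by (simp only: indicator_times)
      also have "\<dots> = emeasure \<pi>13 (A \<times> C)"
        by (rule nn_integral_indicator) (simp add: s13)
      finally show ?thesis .
    qed
    show ?thesis
      unfolding eq
    proof (rule measure_eqI_generator_eq[OF Int_stable_pair_measure_generator pair_measure_closed,
          where A="\<lambda>_. space \<mu>1 \<times> space \<mu>3"])
      show "sets \<pi>13 = sigma_sets (space \<mu>1 \<times> space \<mu>3) {a \<times> b |a b. a \<in> sets \<mu>1 \<and> b \<in> sets \<mu>3}"
        "sets (distr P (\<mu>1 \<Otimes>\<^sub>M \<mu>3) (\<lambda>z. (fst (fst z), g (snd z)))) =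
          sigma_sets (space \<mu>1 \<times> space \<mu>3) {a \<times> b |a b. a \<in> sets \<mu>1 \<and> b \<in> sets \<mu>3}"
        by (simp_all add: s13 sets_pair_measure)
      show "emeasure (distr P (\<mu>1 \<Otimes>\<^sub>M \<mu>3) (\<lambda>z. (fst (fst z), g (snd z)))) (space \<mu>1 \<times> space \<mu>3) \<noteq> \<infinity>"
        using rect[of "space \<mu>1" "space \<mu>3"] by simp
    qed (use rect in auto)
  qed

  \<comment> \<open>The three marginals\<close>
  have marg12: "distr \<pi>12 \<mu>1 fst = \<mu>1" "distr \<pi>12 \<mu>2 snd = \<mu>2" and marg13: "distr \<pi>13 \<mu>3 snd = \<mu>3"
    using assms(12,14) by (auto simp: martingale_couplings2_def couplings2_def)
  have m1: "distr \<pi> \<mu>1 (\<lambda>(x1, x2, x3). x1) = \<mu>1"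
    using marg12(1) unfolding P12[symmetric] Proj12_def
    by (subst (asm) distr_distr) (auto simp: comp_def case_prod_unfold)
  have m2: "distr \<pi> \<mu>2 (\<lambda>(x1, x2, x3). x2) = \<mu>2"
    using marg12(2) unfolding P12[symmetric] Proj12_def
    by (subst (asm) distr_distr) (auto simp: comp_def case_prod_unfold)
  have m3: "distr \<pi> \<mu>3 (\<lambda>(x1, x2, x3). x3) = \<mu>3"
    using marg13 unfolding P13[symmetric] Proj13_def
    by (subst (asm) distr_distr) (auto simp: comp_def case_prod_unfold)
  have "prob_space \<pi>"
    unfolding \<pi>_def by (intro P.prob_space_distr) measurable
  with m1 m2 m3 have coupling: "\<pi> \<in> couplings3 \<mu>1 \<mu>2 \<mu>3"
    by (simp add: couplings3_def space_prob_algebra \<pi>_def)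
  have fst_eq: "distr \<pi> \<mu>1 fst = \<mu>1"
    using m1 by (simp only: case_prod_unfold)

  \<comment> \<open>Barycentre of x3 given (x1, x2)\<close>
  have reassoc: "distr \<pi> ((\<mu>1 \<Otimes>\<^sub>M \<mu>2) \<Otimes>\<^sub>M \<mu>3) (\<lambda>(x1, x2, x3). ((x1, x2), x3)) = joint \<pi>12 \<mu>3 \<kappa>"
  proof -
    have "distr \<pi> ((\<mu>1 \<Otimes>\<^sub>M \<mu>2) \<Otimes>\<^sub>M \<mu>3) (\<lambda>(x1, x2, x3). ((x1, x2), x3)) =
        distr P ((\<mu>1 \<Otimes>\<^sub>M \<mu>2) \<Otimes>\<^sub>M \<mu>3) (\<lambda>(x, \<omega>). (x, g \<omega>))"
      unfolding \<pi>_def by (subst distr_distr) (auto simp: comp_def case_prod_unfold)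
    also have "\<dots> = distr P (\<pi>12 \<Otimes>\<^sub>M \<mu>3) (\<lambda>(x, \<omega>). (x, g \<omega>))"
      by (rule distr_cong) (auto intro!: sets_pair_measure_cong simp: s12)
    finally show ?thesis using joint_\<kappa>(1) by (simp add: \<kappa>_def[abs_def])
  qed
  have mean: "AE x in \<pi>12. (\<integral>x3. x3 \<partial>\<kappa> x) = snd x"
  proof -
    have int: "integrable (L x) q" if x: "x \<in> space \<pi>12" for x
    proof -
      interpret Lx: prob_space "L x" by (rule kernel_prob_space(1)[OF L x])
      show ?thesis
        using q qB kernel_prob_space(2)[OF L x] by (intro Lx.integrable_const_bound[where B=B]) (auto cong: measurable_cong_sets)
    qed
    \<comment> \<open>By \<open>bary\<close> both sides have equal integrals over every E, so they
      agree almost everywhere; the finitely many coordinates are collected afterwards.\<close>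
    have "AE x in \<pi>12. (\<integral>\<omega>. q \<omega> $ i \<partial>L x) = snd x $ i" for i
    proof (rule density_unique_real)
      have qi[measurable]: "(\<lambda>y. y $ i) \<in> borel_measurable borel" for i :: 'd
        by (intro borel_measurable_continuous_onI continuous_intros)
      have "(\<lambda>z. q (snd z) $ i) \<in> borel_measurable (\<pi>12 \<Otimes>\<^sub>M seq_space)"
        by measurable
      from integral_joint(2)[OF \<pi>12 L this, of B] show "integrable \<pi>12 (\<lambda>x. \<integral>\<omega>. q \<omega> $ i \<partial>L x)"
        using order_trans[OF component_le_norm_cart qB] by simp
      obtain R where R: "\<And>y. y \<in> X2 \<Longrightarrow> norm y \<le> R"
        using compact_imp_bounded[OF assms(2)] by (auto simp: bounded_iff)
      show "integrable \<pi>12 (\<lambda>x. snd x $ i)"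
      proof (rule \<pi>12.integrable_const_bound[where B=R])
        show "AE x in \<pi>12. norm (snd x $ i) \<le> R"
          using sets_eq_imp_space_eq[OF s12] order_trans[OF component_le_norm_cart R]
          by (intro AE_I2) (auto simp: space_pair_measure sp2)
        have "(\<lambda>x. snd x) \<in> \<pi>12 \<rightarrow>\<^sub>M borel"
          using measurable_compose[OF measurable_snd id2, of \<mu>1] s12 by (simp cong: measurable_cong_sets)
        then show "(\<lambda>x. snd x $ i) \<in> borel_measurable \<pi>12" by measurable
      qed
      show "(\<integral>x\<in>E. (\<integral>\<omega>. q \<omega> $ i \<partial>L x) \<partial>\<pi>12) = (\<integral>x\<in>E. snd x $ i \<partial>\<pi>12)" if "E \<in> sets \<pi>12" for E
        using bary[OF that, of i] by (simp add: set_lebesgue_integral_def)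
    qed
    then have "AE x in \<pi>12. \<forall>i. (\<integral>\<omega>. q \<omega> $ i \<partial>L x) = snd x $ i"
      by (simp add: AE_all_countable)
    moreover have "AE x in \<pi>12. AE \<omega> in L x. q (snd (x, \<omega>)) \<in> X3"
      by (rule AE_joint[OF L _ qX3[unfolded P_def]]) measurable
    ultimately show ?thesis
      using AE_space
    proof eventually_elim
      case (elim x)
      note Lx = kernel_prob_space(2)[OF L elim(3)]
      have "(\<integral>x3. x3 \<partial>\<kappa> x) = (\<integral>\<omega>. g \<omega> \<partial>L x)"
        unfolding \<kappa>_def using g Lx by (subst integral_distr) (auto cong: measurable_cong_sets)
      also have "\<dots> = (\<integral>\<omega>. q \<omega> \<partial>L x)"
      proof (rule integral_cong_AE)
        show "g \<in> borel_measurable (L x)"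
          using measurable_compose[OF g id3] Lx by (simp cong: measurable_cong_sets)
        show "q \<in> borel_measurable (L x)"
          using q Lx by (simp cong: measurable_cong_sets)
        show "AE \<omega> in L x. g \<omega> = q \<omega>" using elim(2) by eventually_elim (simp add: g_def)
      qed
      also have "\<dots> = snd x"
        using elim(1) integral_bounded_linear[OF bounded_linear_vec_nth int[OF elim(3)]]
        by (simp add: vec_eq_iff)
      finally show ?case .
    qed
  qed

  \<comment> \<open>Disintegration over x1\<close>
  obtain \<kappa>' where \<kappa>': "\<kappa>' \<in> \<mu>1 \<rightarrow>\<^sub>M prob_algebra \<mu>2" and \<pi>12': "\<pi>12 = joint \<mu>1 \<mu>2 \<kappa>'"
    and mean': "AE x1 in \<mu>1. (\<integral>x2. x2 \<partial>\<kappa>' x1) = x1"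
    \<comment> \<open>The martingale property comes with some kernel \<kappa>' of its own. Using
      that one instead of \<open>\<kappa>12\<close> avoids an appeal to uniqueness of
      disintegrations.\<close>
    using assms(12) unfolding martingale_couplings2_def mem_Collect_eq marg12(1) by blast
  define K where "K x = joint (\<kappa>' x) \<mu>3 (\<lambda>y. \<kappa> (x, y))" for x
  note K = joint_assoc[OF \<mu>1 \<kappa>' \<kappa>, folded K_def \<pi>12']
  have \<pi>K: "\<pi> = joint \<mu>1 (\<mu>2 \<Otimes>\<^sub>M \<mu>3) K"
  proof -
    have "distr (joint \<pi>12 \<mu>3 \<kappa>) (\<mu>1 \<Otimes>\<^sub>M (\<mu>2 \<Otimes>\<^sub>M \<mu>3)) (\<lambda>((x, y), z). (x, y, z)) =
        distr \<pi> (\<mu>1 \<Otimes>\<^sub>M (\<mu>2 \<Otimes>\<^sub>M \<mu>3)) (\<lambda>z. z)"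
      unfolding reassoc[symmetric] by (subst distr_distr) (auto simp: comp_def case_prod_unfold)
    also have "\<dots> = \<pi>" by (rule distr_id2) (simp add: \<pi>_def)
    finally show ?thesis using K(2) by (simp add: K_def[abs_def])
  qed
  have meanK: "AE x1 in \<mu>1. (\<integral>(x2, x3). x2 \<partial>K x1) = x1"
    using mean' AE_space
  proof eventually_elim
    case (elim x)
    note k = kernel_prob_space[OF \<kappa>' elim(2)]
    have "(\<lambda>y. \<kappa> (x, y)) \<in> \<mu>2 \<rightarrow>\<^sub>M prob_algebra \<mu>3" using elim(2) by measurable
    then have \<kappa>x: "(\<lambda>y. \<kappa> (x, y)) \<in> \<kappa>' x \<rightarrow>\<^sub>M prob_algebra \<mu>3"
      using k(2) by (simp cong: measurable_cong_sets)
    \<comment> \<open>The mean of x2 depends only on the first marginal of K x, which is \<kappa>'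
      x.\<close>
    have "(\<integral>x2. x2 \<partial>distr (K x) (\<kappa>' x) fst) = (\<integral>z. fst z \<partial>K x)"
    proof (rule integral_distr)
      show "fst \<in> K x \<rightarrow>\<^sub>M \<kappa>' x"
        using sets_joint[OF k(1) \<kappa>x] unfolding K_def by (simp cong: measurable_cong_sets)
      show "(\<lambda>x. x) \<in> borel_measurable (\<kappa>' x)"
        using id2 k(2) by (simp cong: measurable_cong_sets)
    qed
    moreover have "distr (K x) (\<kappa>' x) fst = \<kappa>' x"
      unfolding K_def by (rule distr_joint_fst[OF k(1) \<kappa>x])
    ultimately show ?case using elim(1) by (simp add: case_prod_unfold)
  qed

  have "\<pi> \<in> martingale_couplings3 \<mu>1 \<mu>2 \<mu>3"
    unfolding martingale_couplings3_def P12 fst_eq mem_Collect_eq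
  proof (intro conjI coupling bexI)
    show "\<pi> = joint \<mu>1 (\<mu>2 \<Otimes>\<^sub>M \<mu>3) K" by (rule \<pi>K)
    show "AE x1 in \<mu>1. (\<integral>(x2, x3). x2 \<partial>K x1) = x1" by (rule meanK)
    show "K \<in> \<mu>1 \<rightarrow>\<^sub>M prob_algebra (\<mu>2 \<Otimes>\<^sub>M \<mu>3)" using K(1) by (simp add: K_def[abs_def])
    show "distr \<pi> ((\<mu>1 \<Otimes>\<^sub>M \<mu>2) \<Otimes>\<^sub>M \<mu>3) (\<lambda>(x1, x2, x3). ((x1, x2), x3)) = joint \<pi>12 \<mu>3 \<kappa>" by (rule reassoc)
    show "AE (x1, x2) in \<pi>12. (\<integral>x3. x3 \<partial>\<kappa> (x1, x2)) = x2" using mean by (simp add: case_prod_unfold)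
    show "\<kappa> \<in> \<mu>1 \<Otimes>\<^sub>M \<mu>2 \<rightarrow>\<^sub>M prob_algebra \<mu>3" by (rule \<kappa>)
  qed
  with P12 P13 show ?thesis by blast
qed

end
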